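(* Let $d\ge2$ be an integer. For each of the following five Archimedean families with generator $\psi_\theta$, the copula $C_\theta(\mathbf u)=\psi_\theta(\psi_\theta^{-1}(u_1)+\dots+\psi_\theta^{-1}(u_d))$ has density $c_\theta$ given, for $\mathbf u=(u_1,\dots,u_d)\in(0,1)^d$, as follows, where $t_\theta(\mathbf u)=\sum_{j=1}^d\psi_\theta^{-1}(u_j)$. (1) (Ali-Mikhail-Haq) For $\theta\in[0,1)$ and $\psi_\theta(t)=(1-\theta)/(\exp(t)-\theta)$, $$c_\theta(\mathbf u)=\frac{(1-\theta)^{d+1}}{\theta^2}\,\frac{h^{\mathrm A}_\theta(\mathbf u)}{\prod_{j=1}^du_j^2}\,\mathrm{Li}_{-d}\bigl(h^{\mathrm A}_\theta(\mathbf u)\bigr),\qquad h^{\mathrm A}_\theta(\mathbf u)=\theta\prod_{j=1}^d\frac{u_j}{1-\theta(1-u_j)},$$ where for $\theta=0$ the right-hand side is understood as its limit as $\theta\downarrow0$. (2) (Clayton) For $\theta\in(0,\infty)$ and $\psi_\theta(t)=(1+t)^{-1/\theta}$, $$c_\theta(\mathbf u)=\prod_{k=0}^{d-1}(\theta k+1)\Bigl(\prod_{j=1}^du_j\Bigr)^{-(1+\theta)}(1+t_\theta(\mathbf u))^{-(d+1/\theta)}.$$ (3) (Frank) For $\theta\in(0,\infty)$ and $\psi_\theta(t)=-\log\bigl(1-(1-e^{-\theta})\exp(-t)\bigr)/\theta$, $$c_\theta(\mathbf u)=\Bigl(\frac{\theta}{1-e^{-\theta}}\Bigr)^{d-1}\mathrm{Li}_{-(d-1)}\bigl(h^{\mathrm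 F}_\theta(\mathbf u)\bigr)\,\frac{\exp(-\theta\sum_{j=1}^du_j)}{h^{\mathrm F}_\theta(\mathbf u)},$$ where $h^{\mathrm F}_\theta(\mathbf u)=(1-e^{-\theta})^{1-d}\prod_{j=1}^d(1-\exp(-\theta u_j))$. (4) (Gumbel) For $\theta\in[1,\infty)$ and $\psi_\theta(t)=\exp(-t^{1/\theta})$, $$c_\theta(\mathbf u)=\theta^d\,C_\theta(\mathbf u)\,\frac{\prod_{j=1}^d(-\log u_j)^{\theta-1}}{t_\theta(\mathbf u)^d\prod_{j=1}^du_j}\,P^{\mathrm G}_{d,\theta}\bigl(t_\theta(\mathbf u)^{1/\theta}\bigr).$$ (5) (Joe) For $\theta\in[1,\infty)$ and $\psi_\theta(t)=1-(1-\exp(-t))^{1/\theta}$, $$c_\theta(\mathbf u)=\theta^{d-1}\,\frac{\prod_{j=1}^d(1-u_j)^{\theta-1}}{(1-h^{\mathrm J}_\theta(\mathbf u))^{1-1/\theta}}\,P^{\mathrm J}_{d,\theta}\Bigl(\frac{h^{\mathrm J}_\theta(\mathbf u)}{1-h^{\mathrm J}_\theta(\mathbf u)}\Bigr),\qquad h^{\mathrm J}_\theta(\mathbf u)=\prod_{j=1}^d\bigl(1-(1-u_j)^\theta\bigr).$$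
   Context: An Archimedean copula with generator $\psi:[0,\infty]\to[0,1]$ and inverse $\psi^{-1}:[0,1]\to[0,\infty]$ (with $\psi(\infty)=\lim_{t\to\infty}\psi(t)=0$ and $\psi^{-1}(0)=\inf\{t:\psi(t)=0\}$) is the distribution function $C(\mathbf u)=\psi(\psi^{-1}(u_1)+\dots+\psi^{-1}(u_d))$ on $[0,1]^d$. For the families considered, its density is $c(\mathbf u)=\psi^{(d)}(t(\mathbf u))\prod_{j=1}^d(\psi^{-1})'(u_j)$, $\mathbf u\in(0,1)^d$, with $t(\mathbf u)=\sum_{j=1}^d\psi^{-1}(u_j)$; equivalently $c=\partial^dC/\partial u_1\cdots\partial u_d$. $\mathrm{Li}_s(z)=\sum_{k=1}^\infty z^k/k^s$ ($|z|<1$) is the polylogarithm. The polynomials are $$P^{\mathrm G}_{d,\theta}(x)=\sum_{k=1}^da^{\mathrm G}_{dk}(\theta)x^k,\quad a^{\mathrm G}_{dk}(\theta)=(-1)^{d-k}\sum_{j=k}^d\theta^{-j}s(d,j)S(j,k),$$ $$P^{\mathrm J}_{d,\theta}(x)=\sum_{k=1}^da^{\mathrm J}_{dk}(\theta)x^{k-1},\quad a^{\mathrm J}_{dk}(\theta)=S(d,k)\,(k-1-1/\theta)_{k-1},$$ where $s(d,j)$ are the (signed) Stirling numbers of the first kind, $S(j,k)$ the Stirling numbers of the second kind, and $(x)_n=\prod_{i=0}^{n-1}(x-i)$ the falling factorial (empty product equal to $1$). *)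

theory Defs
  imports "HOL-Probability.Probability" "HOL-Combinatorics.Stirling"
begin

definition polylog :: "real \<Rightarrow> real \<Rightarrow> real" where
  "polylog s z = (\<Sum>k. z ^ Suc k / real (Suc k) powr s)"

definition falling_factorial :: "real \<Rightarrow> nat \<Rightarrow> real" where
  "falling_factorial x n = (\<Prod>i<n. x - real i)"

text \<open>The library's \<^const>\<open>stirling\<close> is the unsigned first kind; only \<open>j \<le> d\<close> is used.\<close>

definition signed_stirling :: "nat \<Rightarrow> nat \<Rightarrow> real" where
  "signed_stirling d j = (- 1) ^ (d - j) * real (stirling d j)"

definition gumbel_coeff :: "nat \<Rightarrow> real \<Rightarrow> nat \<Rightarrow> real" where
  "gumbel_coeff d \<theta> k =
     (- 1) ^ (d - k) * (\<Sum>j = k..d. \<theta> powi (- int j) * signed_stirling d j * real (Stirling j k))"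

definition gumbel_poly :: "nat \<Rightarrow> real \<Rightarrow> real \<Rightarrow> real" where
  "gumbel_poly d \<theta> x = (\<Sum>k = 1..d. gumbel_coeff d \<theta> k * x ^ k)"

definition joe_coeff :: "nat \<Rightarrow> real \<Rightarrow> nat \<Rightarrow> real" where
  "joe_coeff d \<theta> k = real (Stirling d k) * falling_factorial (real k - 1 - 1 / \<theta>) (k - 1)"

definition joe_poly :: "nat \<Rightarrow> real \<Rightarrow> real \<Rightarrow> real" where
  "joe_poly d \<theta> x = (\<Sum>k = 1..d. joe_coeff d \<theta> k * x ^ (k - 1))"

text \<open>
  A generator is a function \<open>\<psi> :: real \<Rightarrow> real\<close> of which only the values on
  \<open>[0,\<infinity>)\<close> matter. Its inverse takes the value \<open>inf {t. \<psi> t = 0}\<close> at \<open>0\<close>, which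
  is \<open>\<infinity>\<close> if \<open>\<psi>\<close> is positive. Hence two versions of the inverse: the real-valued
  \<open>gen_inv\<close>, meaningful on \<open>(0,1]\<close>, and \<open>gen_inv_ext\<close> on all of \<open>[0,1]\<close>, paired with
  the extension \<open>gen_ext\<close> of \<open>\<psi>\<close> to \<open>[0,\<infinity>]\<close>.
\<close>

definition gen_inv :: "(real \<Rightarrow> real) \<Rightarrow> real \<Rightarrow> real" where
  "gen_inv \<psi> = the_inv_into {0..} \<psi>"

definition gen_inv_ext :: "(real \<Rightarrow> real) \<Rightarrow> real \<Rightarrow> ereal" where
  "gen_inv_ext \<psi> u =
     (if u = 0 then Inf (ereal ` {t. 0 \<le> t \<and> \<psi> t = 0}) else ereal (gen_inv \<psi> u))"

definition gen_ext :: "(real \<Rightarrow> real) \<Rightarrow> ereal \<Rightarrow> real" where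
  "gen_ext \<psi> x = (if x = \<infinity> then Lim at_top \<psi> else \<psi> (real_of_ereal x))"

definition arch_copula :: "nat \<Rightarrow> (real \<Rightarrow> real) \<Rightarrow> (nat \<Rightarrow> real) \<Rightarrow> real" where
  "arch_copula d \<psi> u = gen_ext \<psi> (\<Sum>j = 1..d. gen_inv_ext \<psi> (u j))"

definition gen_sum :: "nat \<Rightarrow> (real \<Rightarrow> real) \<Rightarrow> (nat \<Rightarrow> real) \<Rightarrow> real" where
  "gen_sum d \<psi> u = (\<Sum>j = 1..d. gen_inv \<psi> (u j))"

abbreviation closed_cube :: "nat \<Rightarrow> (nat \<Rightarrow> real) set" where
  "closed_cube d \<equiv> {1..d} \<rightarrow>\<^sub>E {0..1}"

abbreviation open_cube :: "nat \<Rightarrow> (nat \<Rightarrow> real) set" where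
  "open_cube d \<equiv> {1..d} \<rightarrow>\<^sub>E {0<..<1}"

text \<open>
  \<open>c\<close> is a Lebesgue density, carried by the open unit cube, of the distribution function
  \<open>C\<close> on the closed unit cube. Nonnegativity is required because \<^const>\<open>ennreal\<close>
  truncates negative values.
\<close>

definition is_lebesgue_density ::
  "nat \<Rightarrow> ((nat \<Rightarrow> real) \<Rightarrow> real) \<Rightarrow> ((nat \<Rightarrow> real) \<Rightarrow> real) \<Rightarrow> bool" where
  "is_lebesgue_density d C c \<longleftrightarrow>
     (let M = Pi\<^sub>M {1..d} (\<lambda>_. lborel); f = (\<lambda>v. indicator (open_cube d) v * c v) in
       f \<in> borel_measurable M \<and>
       (\<forall>v\<in>open_cube d. 0 \<le> c v) \<and>
       (\<forall>u\<in>closed_cube d.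
          emeasure (density M (\<lambda>v. ennreal (f v))) (\<Pi>\<^sub>E j\<in>{1..d}. {..u j}) = ennreal (C u)))"

text \<open>
  The pointwise version \<open>\<psi>\<^sup>(\<^sup>d\<^sup>)(t(u)) \<Prod>\<^sub>j (\<psi>\<^sup>-\<^sup>1)'(u\<^sub>j)\<close>. Since \<^const>\<open>deriv\<close> is total,
  the existence of all the derivatives involved is stated separately in \<open>arch_has_density\<close>.
\<close>

definition arch_density :: "nat \<Rightarrow> (real \<Rightarrow> real) \<Rightarrow> (nat \<Rightarrow> real) \<Rightarrow> real" where
  "arch_density d \<psi> u =
     (deriv ^^ d) \<psi> (gen_sum d \<psi> u) * (\<Prod>j = 1..d. deriv (gen_inv \<psi>) (u j))"

definition arch_has_density :: "nat \<Rightarrow> (real \<Rightarrow> real) \<Rightarrow> ((nat \<Rightarrow> real) \<Rightarrow> real) \<Rightarrow> bool" where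
  "arch_has_density d \<psi> c \<longleftrightarrow>
     is_lebesgue_density d (arch_copula d \<psi>) c \<and>
     (\<forall>k<d. \<forall>t>0. (deriv ^^ k) \<psi> differentiable (at t)) \<and>
     (\<forall>x\<in>{0<..<1}. gen_inv \<psi> differentiable (at x)) \<and>
     (\<forall>u\<in>open_cube d. c u = arch_density d \<psi> u)"

definition amh_gen :: "real \<Rightarrow> real \<Rightarrow> real" where
  "amh_gen \<theta> t = (1 - \<theta>) / (exp t - \<theta>)"

definition amh_h :: "nat \<Rightarrow> real \<Rightarrow> (nat \<Rightarrow> real) \<Rightarrow> real" where
  "amh_h d \<theta> u = \<theta> * (\<Prod>j = 1..d. u j / (1 - \<theta> * (1 - u j)))"

definition amh_density :: "nat \<Rightarrow> real \<Rightarrow> (nat \<Rightarrow> real) \<Rightarrow> real" where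
  "amh_density d \<theta> u =
     (1 - \<theta>) ^ (d + 1) / \<theta>\<^sup>2 * (amh_h d \<theta> u / (\<Prod>j = 1..d. (u j)\<^sup>2)) *
     polylog (- real d) (amh_h d \<theta> u)"

definition clayton_gen :: "real \<Rightarrow> real \<Rightarrow> real" where
  "clayton_gen \<theta> t = (1 + t) powr (- 1 / \<theta>)"

definition clayton_density :: "nat \<Rightarrow> real \<Rightarrow> (nat \<Rightarrow> real) \<Rightarrow> real" where
  "clayton_density d \<theta> u =
     (\<Prod>k<d. \<theta> * real k + 1) * (\<Prod>j = 1..d. u j) powr (- (1 + \<theta>)) *
     (1 + gen_sum d (clayton_gen \<theta>) u) powr (- (real d + 1 / \<theta>))"

definition frank_gen :: "real \<Rightarrow> real \<Rightarrow> real" where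
  "frank_gen \<theta> t = - ln (1 - (1 - exp (- \<theta>)) * exp (- t)) / \<theta>"

definition frank_h :: "nat \<Rightarrow> real \<Rightarrow> (nat \<Rightarrow> real) \<Rightarrow> real" where
  "frank_h d \<theta> u = (1 - exp (- \<theta>)) powi (1 - int d) * (\<Prod>j = 1..d. 1 - exp (- \<theta> * u j))"

definition frank_density :: "nat \<Rightarrow> real \<Rightarrow> (nat \<Rightarrow> real) \<Rightarrow> real" where
  "frank_density d \<theta> u =
     (\<theta> / (1 - exp (- \<theta>))) ^ (d - 1) * polylog (- (real d - 1)) (frank_h d \<theta> u) *
     (exp (- \<theta> * (\<Sum>j = 1..d. u j)) / frank_h d \<theta> u)"

definition gumbel_gen :: "real \<Rightarrow> real \<Rightarrow> real" where
  "gumbel_gen \<theta> t = exp (- (t powr (1 / \<theta>)))"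

definition gumbel_density :: "nat \<Rightarrow> real \<Rightarrow> (nat \<Rightarrow> real) \<Rightarrow> real" where
  "gumbel_density d \<theta> u =
     \<theta> ^ d * arch_copula d (gumbel_gen \<theta>) u *
     ((\<Prod>j = 1..d. (- ln (u j)) powr (\<theta> - 1)) /
      (gen_sum d (gumbel_gen \<theta>) u ^ d * (\<Prod>j = 1..d. u j))) *
     gumbel_poly d \<theta> (gen_sum d (gumbel_gen \<theta>) u powr (1 / \<theta>))"

definition joe_gen :: "real \<Rightarrow> real \<Rightarrow> real" where
  "joe_gen \<theta> t = 1 - (1 - exp (- t)) powr (1 / \<theta>)"

definition joe_h :: "nat \<Rightarrow> real \<Rightarrow> (nat \<Rightarrow> real) \<Rightarrow> real" where
  "joe_h d \<theta> u = (\<Prod>j = 1..d. 1 - (1 - u j) powr \<theta>)"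

definition joe_density :: "nat \<Rightarrow> real \<Rightarrow> (nat \<Rightarrow> real) \<Rightarrow> real" where
  "joe_density d \<theta> u =
     \<theta> ^ (d - 1) *
     ((\<Prod>j = 1..d. (1 - u j) powr (\<theta> - 1)) / (1 - joe_h d \<theta> u) powr (1 - 1 / \<theta>)) *
     joe_poly d \<theta> (joe_h d \<theta> u / (1 - joe_h d \<theta> u))"

end

theory Submission
  imports Defs
begin

text \<open>
  All five generators are completely monotone: \<open>(- 1)\<^sup>n \<psi>\<^sup>(\<^sup>n\<^sup>) \<ge> 0\<close> on \<open>(0,\<infinity>)\<close> for every \<open>n\<close>. For such a
  generator with inverse \<open>\<phi>\<close>, the pointwise mixed derivative
  \<open>\<psi>\<^sup>(\<^sup>d\<^sup>)(\<Sum>\<^sub>j \<phi>(v\<^sub>j)) \<Prod>\<^sub>j \<phi>'(v\<^sub>j)\<close> is nonnegative, and it is a density of the copula in the sense of measures,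
  with no mass lost to the boundary. Indeed, by Tonelli the integral over a box can be computed one
  coordinate at a time. In a single coordinate the integrand is an exact derivative, so the
  integration undoes one differentiation, and the boundary term at \<open>v\<^sub>j = 0\<close>, where \<open>\<phi>\<close> is infinite, vanishes
  because every derivative of \<open>\<psi>\<close> decays at infinity. After \<open>d\<close> steps \<open>\<psi>(\<Sum>\<^sub>j \<phi>(u\<^sub>j))\<close> is left. This argument is
  carried out once, in the locale \<open>cm_generator\<close>; its lemma \<open>integrate_all_coordinates\<close> is the induction
  and its theorem \<open>has_density\<close> the outcome.

  Each family then needs a closed form of its derivatives with a visible sign. For Ali-Mikhail-Haq and
  Frank, the derivatives are power series in \<open>e\<^sup>-\<^sup>t\<close> with positive coefficients, namely polylogarithms of negative
  order. Clayton's generator is a power. For Gumbel and Joe, the \<open>n\<close>-th derivative is an elementary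
  factor times a polynomial in \<open>t\<^bsup>1/\<theta>\<^esup>\<close> or in \<open>e\<^sup>-\<^sup>t / (1 - e\<^sup>-\<^sup>t)\<close>; differentiating once more gives a recursion for its
  coefficients, which the expressions in Stirling numbers satisfy and from which nonnegativity is
  read off (\<open>gumbel_coeff_rec\<close>, \<open>gumbel_coeff_nonneg\<close>, \<open>joe_poly_Suc\<close>, \<open>joe_poly_nonneg\<close>).

  The Ali-Mikhail-Haq density is \<open>\<theta>\<^sup>-\<^sup>2\<close> times an expression that vanishes to second order at \<open>\<theta> = 0\<close>. After
  cancellation, one formula covers the whole range \<open>0 \<le> \<theta> < 1\<close>, and continuity in \<open>\<theta>\<close> identifies the limit at
  \<open>0\<close> (\<open>amh_has_density_ext\<close>, \<open>amh_density_limit\<close>).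
\<close>

section \<open>Copulas with a completely monotone generator\<close>

lemma open_cubeD: "u \<in> open_cube d \<Longrightarrow> j \<in> {1..d} \<Longrightarrow> 0 < u j \<and> u j < 1"
  by (auto simp: PiE_iff)

text \<open>
  The sequence \<open>g\<close> carries closed forms of \<open>(- 1)\<^sup>n \<psi>\<^sup>(\<^sup>n\<^sup>)\<close>. Its sign condition is complete monotonicity.
  The derivatives may blow up at \<open>0\<close> (for the Gumbel and Joe families with \<open>\<theta> > 1\<close> they do), so they are controlled
  on \<open>(0,\<infinity>)\<close> only and the behaviour of \<open>\<psi>\<close> at \<open>0\<close> is prescribed by a one-sided limit.
\<close>

locale cm_generator =
  fixes \<psi> :: "real \<Rightarrow> real" and g :: "nat \<Rightarrow> real \<Rightarrow> real"
  assumes g_0: "\<And>t. 0 \<le> t \<Longrightarrow> g 0 t = \<psi> t"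
    and psi_0: "\<psi> 0 = 1"
    and psi_at_0: "(\<psi> \<longlongrightarrow> 1) (at_right 0)"
    and psi_at_top: "(\<psi> \<longlongrightarrow> 0) at_top"
    and g_deriv: "\<And>n t. 0 < t \<Longrightarrow> (g n has_real_derivative - g (Suc n) t) (at t)"
    and g_nonneg: "\<And>n t. 0 < t \<Longrightarrow> 0 \<le> g n t"
    and g_1_pos: "\<And>t. 0 < t \<Longrightarrow> 0 < g 1 t"
begin

abbreviation \<phi> :: "real \<Rightarrow> real" where "\<phi> \<equiv> gen_inv \<psi>"

lemma psi_deriv:
  assumes "0 < t"
  shows "(\<psi> has_real_derivative - g 1 t) (at t)"
proof -
  have "(g 0 has_real_derivative - g 1 t) (at t)" using g_deriv[OF assms, of 0] by simp
  then show ?thesis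
    by (rule has_field_derivative_transform_within_open[of _ _ _ "{0<..}"]) (use assms g_0 in auto)
qed

lemma psi_continuous: "continuous_on {0..} \<psi>"
  unfolding continuous_on
proof
  fix t :: real assume t: "t \<in> {0..}"
  show "(\<psi> \<longlongrightarrow> \<psi> t) (at t within {0..})"
  proof (cases "t = 0")
    case True
    have "at 0 within {0..} = at_right (0::real)"
      by (rule at_within_Ici_at_right)
    then show ?thesis using True psi_at_0 psi_0 by simp
  next
    case False
    then have "0 < t" using t by auto
    then have "isCont \<psi> t" using psi_deriv DERIV_isCont by blast
    then show ?thesis using continuous_within_subset[of t UNIV \<psi>] by (simp add: continuous_within)
  qed
qed

lemma psi_strict_antimono:
  assumes "0 \<le> s" "s < t"
  shows "\<psi> t < \<psi> s"
proof (rule DERIV_neg_imp_decreasing_open[OF assms(2)])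
  show "\<exists>y. (\<psi> has_real_derivative y) (at x) \<and> y < 0" if "s < x" for x
    using that assms psi_deriv[of x] g_1_pos[of x] by force
  show "continuous_on {s..t} \<psi>"
    by (rule continuous_on_subset[OF psi_continuous]) (use assms in auto)
qed

lemma psi_pos:
  assumes "0 \<le> t"
  shows "0 < \<psi> t"
proof -
  have "eventually (\<lambda>s. \<psi> s \<le> \<psi> (t + 1)) at_top"
    using eventually_ge_at_top[of "t + 1"]
  proof eventually_elim
    case (elim s)
    then show ?case
      using psi_strict_antimono[of "t + 1" s] assms by (cases "s = t + 1") auto
  qed
  then have "0 \<le> \<psi> (t + 1)"
    by (rule tendsto_upperbound[OF psi_at_top]) simp
  then show ?thesis using psi_strict_antimono[of t "t + 1"] assms by simp
qed

lemma psi_inj: "inj_on \<psi> {0..}"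
proof (rule inj_onI)
  fix s t assume "s \<in> {0..}" "t \<in> {0..}" "\<psi> s = \<psi> t"
  then show "s = t"
    using psi_strict_antimono[of s t] psi_strict_antimono[of t s] linorder_less_linear[of s t] by auto
qed

text \<open>
  A family determines its inverse through this lemma: it suffices to exhibit a preimage of \<open>u\<close>.
\<close>

lemma gen_inv_eq:
  assumes "0 \<le> t" "\<psi> t = u"
  shows "\<phi> u = t"
  unfolding gen_inv_def using assms psi_inj by (intro the_inv_into_f_eq) auto

lemma psi_onto:
  assumes "0 < u" "u \<le> 1"
  shows "\<exists>t\<ge>0. \<psi> t = u"
proof -
  have "eventually (\<lambda>t. \<psi> t < u \<and> 0 \<le> t) at_top"
    using order_tendstoD(2)[OF psi_at_top assms(1)] eventually_ge_at_top[of 0]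
    by eventually_elim auto
  from eventually_happens[OF this] obtain b where b: "\<psi> b < u" "0 \<le> b"
    by auto
  have "\<exists>x\<ge>0. x \<le> b \<and> \<psi> x = u"
    using b assms psi_0
    by (intro IVT2') (auto intro: continuous_on_subset[OF psi_continuous])
  then show ?thesis by auto
qed

lemma gen_inv_nonneg: "0 < u \<Longrightarrow> u \<le> 1 \<Longrightarrow> 0 \<le> \<phi> u"
  and psi_gen_inv: "0 < u \<Longrightarrow> u \<le> 1 \<Longrightarrow> \<psi> (\<phi> u) = u"
  using psi_onto gen_inv_eq by metis+

lemma gen_inv_psi: "0 \<le> t \<Longrightarrow> \<phi> (\<psi> t) = t"
  using gen_inv_eq by blast

lemma gen_inv_1: "\<phi> 1 = 0"
  using gen_inv_eq[of 0] psi_0 by simp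

text \<open>
  Since \<open>\<psi>\<close> is strictly decreasing, comparisons of \<open>\<phi> u\<close> with a number \<open>t\<close> become comparisons of \<open>u\<close> with
  \<open>\<psi> t\<close>. The limits of the inverse at both ends of the unit interval follow from this alone.
\<close>

lemma psi_compare:
  assumes "0 \<le> t" "0 < u" "u \<le> 1"
  shows gen_inv_less_iff: "\<phi> u < t \<longleftrightarrow> \<psi> t < u"
    and less_gen_inv_iff: "t < \<phi> u \<longleftrightarrow> u < \<psi> t"
proof -
  have "\<psi> t < u" if "\<phi> u < t"
    using psi_strict_antimono[OF gen_inv_nonneg that] psi_gen_inv assms by simp
  moreover have "u < \<psi> t" if "t < \<phi> u"
    using psi_strict_antimono[OF _ that] psi_gen_inv assms by simp
  moreover have "\<psi> t = u" if "t = \<phi> u"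
    using psi_gen_inv that assms by simp
  ultimately show "\<phi> u < t \<longleftrightarrow> \<psi> t < u" "t < \<phi> u \<longleftrightarrow> u < \<psi> t"
    using linorder_less_linear[of "\<phi> u" t] by auto
qed

lemma gen_inv_pos: "0 < u \<Longrightarrow> u < 1 \<Longrightarrow> 0 < \<phi> u"
  using less_gen_inv_iff[of 0 u] psi_0 by simp

lemma gen_inv_isCont:
  assumes "0 < u" "u < 1"
  shows "isCont \<phi> u"
proof -
  let ?t = "\<phi> u"
  have t: "0 < ?t" using assms by (rule gen_inv_pos)
  have "isCont \<phi> (\<psi> ?t)"
  proof (rule isCont_inverse_function2[of "?t / 2" ?t "?t + 1"])
    show "isCont \<psi> z" if "?t / 2 \<le> z" for z
      using that t psi_deriv[of z] DERIV_isCont by fastforce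
  qed (use t gen_inv_psi in auto)
  then show ?thesis using psi_gen_inv assms by simp
qed

lemma gen_inv_deriv:
  assumes "0 < u" "u < 1"
  shows "(\<phi> has_real_derivative - (1 / g 1 (\<phi> u))) (at u)"
proof -
  have "(\<phi> has_real_derivative inverse (- g 1 (\<phi> u))) (at u)"
  proof (rule DERIV_inverse_function[where f = \<psi> and a = 0 and b = 1])
    show "(\<psi> has_real_derivative - g 1 (\<phi> u)) (at (\<phi> u))"
      using assms gen_inv_pos psi_deriv by blast
    show "- g 1 (\<phi> u) \<noteq> 0" using g_1_pos[OF gen_inv_pos[OF assms]] by simp
  qed (use assms psi_gen_inv gen_inv_isCont in auto)
  then show ?thesis by (simp add: field_simps)
qed

lemma gen_inv_at_0: "filterlim \<phi> at_top (at_right 0)"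
  unfolding filterlim_at_top_ge[where c = 0]
proof (intro allI impI)
  fix K :: real assume K: "0 \<le> K"
  have "0 < min 1 (\<psi> K)" using psi_pos[OF K] by simp
  then have "eventually (\<lambda>v. 0 < v \<and> v < min 1 (\<psi> K)) (at_right 0)"
    by (rule eventually_at_rightI[rotated]) auto
  then show "eventually (\<lambda>v. K \<le> \<phi> v) (at_right 0)"
    by eventually_elim (use less_gen_inv_iff K in force)
qed

lemma gen_inv_at_left:
  assumes "0 < u" "u \<le> 1"
  shows "(\<phi> \<longlongrightarrow> \<phi> u) (at_left u)"
proof (cases "u = 1")
  case False
  then have "isCont \<phi> u" using gen_inv_isCont assms by simp
  then show ?thesis by (simp add: isCont_def filterlim_at_split)
next
  case True
  have "(\<phi> \<longlongrightarrow> 0) (at_left 1)"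
  proof (rule order_tendstoI)
    have *: "eventually (\<lambda>v. 0 < v \<and> v < 1) (at_left (1::real))"
      by (rule eventually_at_leftI[of 0]) auto
    show "eventually (\<lambda>v. a < \<phi> v) (at_left 1)" if "a < 0" for a
      using * by eventually_elim (use gen_inv_pos that in force)
    show "eventually (\<lambda>v. \<phi> v < a) (at_left 1)" if a: "0 < a" for a
    proof -
      have "\<psi> a < 1" using psi_strict_antimono[of 0 a] a psi_0 by simp
      then have "eventually (\<lambda>v. \<psi> a < v) (at_left 1)"
        by (intro eventually_at_leftI[of "\<psi> a"]) auto
      with * show ?thesis
        by eventually_elim (use gen_inv_less_iff a in force)
    qed
  qed
  then show ?thesis using True gen_inv_1 by simp
qed

lemma iterated_deriv_psi:
  assumes "0 < t"
  shows "(deriv ^^ n) \<psi> t = (- 1) ^ n * g n t"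
    and "((deriv ^^ n) \<psi> has_real_derivative (- 1) ^ Suc n * g (Suc n) t) (at t)"
proof -
  have "(\<forall>t>0. (deriv ^^ n) \<psi> t = (- 1) ^ n * g n t) \<and>
      (\<forall>t>0. ((deriv ^^ n) \<psi> has_real_derivative (- 1) ^ Suc n * g (Suc n) t) (at t))"
  proof (induction n)
    case 0
    have "(\<psi> has_real_derivative (- 1) ^ Suc 0 * g (Suc 0) t) (at t)" if "0 < t" for t
      using psi_deriv[OF that] by simp
    then show ?case by (auto simp: g_0)
  next
    case (Suc n)
    have eq: "(deriv ^^ Suc n) \<psi> t = (- 1) ^ Suc n * g (Suc n) t" if "t > 0" for t
    proof -
      have "((deriv ^^ n) \<psi> has_real_derivative (- 1) ^ Suc n * g (Suc n) t) (at t)"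
        using Suc that by blast
      from DERIV_imp_deriv[OF this] show ?thesis by simp
    qed
    have "((deriv ^^ Suc n) \<psi> has_real_derivative (- 1) ^ Suc (Suc n) * g (Suc (Suc n)) t) (at t)"
      if t: "t > 0" for t
    proof (rule has_field_derivative_transform_within_open)
      show "((\<lambda>t. (- 1) ^ Suc n * g (Suc n) t) has_real_derivative
          (- 1) ^ Suc (Suc n) * g (Suc (Suc n)) t) (at t)"
        using DERIV_cmult[OF g_deriv[OF t, of "Suc n"], of "(- 1) ^ Suc n"] by simp
      show "open {0::real<..}" "t \<in> {0<..}" using t by auto
      show "(- 1) ^ Suc n * g (Suc n) s = (deriv ^^ Suc n) \<psi> s" if "s \<in> {0<..}" for s
        using eq[of s] that by simp
    qed
    then show ?case using eq by blast
  qed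
  then show "(deriv ^^ n) \<psi> t = (- 1) ^ n * g n t"
    "((deriv ^^ n) \<psi> has_real_derivative (- 1) ^ Suc n * g (Suc n) t) (at t)"
    using assms by blast+
qed

lemma g_antimono:
  assumes "0 < s" "s \<le> t"
  shows "g n t \<le> g n s"
proof (rule DERIV_nonpos_imp_nonincreasing[OF assms(2)])
  fix x assume "s \<le> x"
  then have "0 < x" using assms by simp
  then show "\<exists>y. (g n has_real_derivative y) (at x) \<and> y \<le> 0"
    using g_deriv[of x n] g_nonneg[of x "Suc n"] by (intro exI[of _ "- g (Suc n) x"]) simp
qed

text \<open>
  The boundary terms at \<open>v = 0\<close> in the integrals below are values of \<open>g n\<close> at infinity. They vanish: as
  \<open>g (Suc n)\<close> is decreasing, the mean value theorem bounds \<open>g (Suc n) t\<close> by the increment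
  \<open>g n (t - 1) - g n t\<close>, which tends to \<open>0\<close> when \<open>g n\<close> does.
\<close>

lemma g_at_top: "(g n \<longlongrightarrow> 0) at_top"
proof (induction n)
  case 0
  show ?case
    by (rule Lim_transform_eventually[OF psi_at_top], rule eventually_mono[OF eventually_ge_at_top[of 0]])
      (simp add: g_0)
next
  case (Suc n)
  have lim: "((\<lambda>t. g n (t - 1) - g n t) \<longlongrightarrow> 0 - 0) at_top"
  proof (rule tendsto_diff[OF _ Suc])
    show "((\<lambda>t. g n (t - 1)) \<longlongrightarrow> 0) at_top"
      by (rule filterlim_compose[OF Suc])
        (use filterlim_tendsto_add_at_top[OF tendsto_const filterlim_ident, of "-1"] in simp)
  qed
  have bound: "g (Suc n) t \<le> g n (t - 1) - g n t" if "1 < t" for t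
  proof -
    have "\<exists>z. t - 1 < z \<and> z < t \<and> g n t - g n (t - 1) = (t - (t - 1)) * - g (Suc n) z"
      by (rule MVT2) (use that g_deriv in auto)
    then obtain z where "t - 1 < z" "z < t" "g n t - g n (t - 1) = - g (Suc n) z" by auto
    moreover have "g (Suc n) t \<le> g (Suc n) z"
      using calculation that by (intro g_antimono) auto
    ultimately show ?thesis by linarith
  qed
  show ?case
  proof (rule tendsto_sandwich[OF _ _ tendsto_const])
    show "eventually (\<lambda>t. 0 \<le> g (Suc n) t) at_top"
      using eventually_gt_at_top[of 0] by eventually_elim (rule g_nonneg)
    show "eventually (\<lambda>t. g (Suc n) t \<le> g n (t - 1) - g n t) at_top"
      using eventually_gt_at_top[of 1] by eventually_elim (rule bound)
  qed (use lim in simp)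
qed

text \<open>
  The locale says nothing about \<open>g n\<close> at negative arguments, nor about \<open>\<phi>\<close> outside \<open>(0,1]\<close>, so they need
  not be measurable on the whole line; the integrals are written with the following Borel versions.
  The default value \<open>1 = \<psi> 0\<close> makes the version of \<open>g 0\<close> correct at \<open>0\<close> too, so that the empty set of
  coordinates can serve as the base of the induction.
\<close>

definition g_borel :: "nat \<Rightarrow> real \<Rightarrow> real" where
  "g_borel n t = (if 0 < t then g n t else 1)"

definition phi_borel :: "real \<Rightarrow> real" where
  "phi_borel v = indicator {0<..<1} v * \<phi> v"

text \<open>
  On \<open>(0,1)\<close> this is \<open>- \<phi>'\<close>, the Jacobian of the change of variables in one coordinate.
\<close>

definition weight :: "real \<Rightarrow> real" where
  "weight v = indicator {0<..<1} v * (1 / g 1 (\<phi> v))"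

lemma g_continuous: "continuous_on {0<..} (g n)"
  by (rule DERIV_continuous_on[of _ _ "\<lambda>t. - g (Suc n) t"])
    (use g_deriv in \<open>auto intro: has_field_derivative_at_within\<close>)

lemma gen_inv_continuous: "continuous_on {0<..<1} \<phi>"
  using gen_inv_isCont by (auto intro!: continuous_at_imp_continuous_on)

lemma g_gen_inv_continuous: "continuous_on {0<..<1} (\<lambda>v. g n (s + \<phi> v))" if "0 \<le> s"
  by (rule continuous_on_compose2[OF g_continuous])
    (use that gen_inv_pos in \<open>auto intro!: continuous_intros gen_inv_continuous add_nonneg_pos\<close>)

lemma inverse_g_continuous: "continuous_on {0<..<1} (\<lambda>v. 1 / g 1 (\<phi> v))"
  using g_gen_inv_continuous[of 0 1] gen_inv_pos g_1_pos
  by (auto intro!: continuous_intros simp: less_imp_neq[symmetric])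

lemma g_borel_measurable [measurable]: "g_borel n \<in> borel_measurable borel"
proof -
  have "(\<lambda>t. indicator {0<..} t *\<^sub>R g n t) \<in> borel_measurable borel"
    by (intro borel_measurable_continuous_on_indicator g_continuous) auto
  then have "(\<lambda>t. indicator {0<..} t *\<^sub>R g n t + indicator {..0} t) \<in> borel_measurable borel"
    by measurable
  also have "(\<lambda>t. indicator {0<..} t *\<^sub>R g n t + indicator {..0} t) = g_borel n"
    by (auto simp: g_borel_def indicator_def)
  finally show ?thesis .
qed

lemma phi_borel_measurable [measurable]: "phi_borel \<in> borel_measurable borel"
  using borel_measurable_continuous_on_indicator[OF _ gen_inv_continuous]
  by (simp add: phi_borel_def[abs_def])

lemma weight_measurable [measurable]: "weight \<in> borel_measurable borel"
  using borel_measurable_continuous_on_indicator[OF _ inverse_g_continuous]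
  by (simp add: weight_def[abs_def])

lemma phi_borel_nonneg: "0 \<le> phi_borel v"
  using gen_inv_pos[of v] by (auto simp: phi_borel_def indicator_def)

lemma weight_nonneg: "0 \<le> weight v"
  using gen_inv_pos[of v] g_1_pos[of "\<phi> v"] by (auto simp: weight_def indicator_def)

lemma g_borel_nonneg: "0 \<le> g_borel n t"
  using g_nonneg by (simp add: g_borel_def)

lemma g_borel_eq:
  assumes "0 < t \<or> n = 0 \<and> t = 0"
  shows "g_borel n t = g n t"
  using assms g_0 psi_0 by (auto simp: g_borel_def)

text \<open>
  Because \<open>weight\<close> is \<open>- \<phi>'\<close>, the integrand is the derivative of \<open>v \<mapsto> g n (s + \<phi> v)\<close>, and the fundamental
  theorem of calculus applies; the contribution at \<open>v \<rightarrow> 0\<close> is \<open>g n \<infinity> = 0\<close>. At \<open>u = 1\<close> and \<open>s = 0\<close> the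
  upper boundary term is the limit of \<open>g n\<close> at \<open>0\<close>, which may be infinite unless \<open>n = 0\<close>.
\<close>

lemma integrate_one_coordinate:
  assumes u: "0 < u" "u \<le> 1" and s: "0 \<le> s" "n = 0 \<or> 0 < s"
  shows "(\<integral>\<^sup>+v. ennreal (g_borel (Suc n) (s + phi_borel v)) * (ennreal (weight v) * indicator {..u} v) \<partial>lborel)
    = ennreal (g n (s + \<phi> u))"
proof -
  let ?f = "\<lambda>v. g (Suc n) (s + \<phi> v) * (1 / g 1 (\<phi> v))"
  let ?F = "\<lambda>v. g n (s + \<phi> v)"
  have ein: "einterval (ereal 0) (ereal u) = {0<..<u}" by (simp add: einterval_eq)
  have pos: "0 < s + \<phi> v" if "0 < v" "v < u" for v
    using that u s gen_inv_pos[of v] by simp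
  have der: "(?F has_real_derivative ?f v) (at v)" if "0 < v" "v < u" for v
  proof -
    have "((\<lambda>v. s + \<phi> v) has_real_derivative - (1 / g 1 (\<phi> v))) (at v)"
      using gen_inv_deriv[of v] that u by (auto intro!: derivative_eq_intros)
    from DERIV_chain2[where f = "g n" and g = "\<lambda>v. s + \<phi> v", OF g_deriv[OF pos[OF that]] this]
    show ?thesis by simp
  qed
  have cont: "isCont ?f v" if "0 < v" "v < u" for v
  proof -
    have "continuous_on {0<..<1} ?f"
      by (intro continuous_on_mult g_gen_inv_continuous inverse_g_continuous s)
    then show ?thesis using that u by (auto simp: continuous_on_eq_continuous_at)
  qed
  have nonneg: "0 \<le> ?f v" if "0 < v" "v < u" for v
    using pos[OF that] that u g_nonneg gen_inv_pos[of v] by (intro mult_nonneg_nonneg) auto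
  have lim0: "(?F \<longlongrightarrow> 0) (at_right 0)"
    by (rule filterlim_compose[OF g_at_top])
      (intro filterlim_tendsto_add_at_top[OF tendsto_const gen_inv_at_0])
  have arg: "((\<lambda>v. s + \<phi> v) \<longlongrightarrow> s + \<phi> u) (at_left u)"
    by (intro tendsto_intros gen_inv_at_left u)
  have lim1: "(?F \<longlongrightarrow> g n (s + \<phi> u)) (at_left u)"
  proof (cases "n = 0")
    case True
    have ev: "eventually (\<lambda>v. 0 < v \<and> v < u) (at_left u)"
      by (rule eventually_at_leftI[of 0]) (use u in auto)
    have "((\<lambda>v. \<psi> (s + \<phi> v)) \<longlongrightarrow> \<psi> (s + \<phi> u)) (at_left u)"
    proof (rule continuous_on_tendsto_compose[OF psi_continuous arg])
      show "eventually (\<lambda>v. s + \<phi> v \<in> {0..}) (at_left u)"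
        using ev by eventually_elim (use pos in force)
    qed (use s u gen_inv_nonneg in auto)
    then have "((\<lambda>v. \<psi> (s + \<phi> v)) \<longlongrightarrow> g n (s + \<phi> u)) (at_left u)"
      using True s u gen_inv_nonneg by (simp add: g_0)
    moreover have "eventually (\<lambda>v. \<psi> (s + \<phi> v) = ?F v) (at_left u)"
      using ev by eventually_elim (use pos True g_0 in force)
    ultimately show ?thesis by (rule Lim_transform_eventually)
  next
    case False
    then have "0 < s + \<phi> u" using s u gen_inv_nonneg[of u] by simp
    then have "isCont (g n) (s + \<phi> u)" using g_deriv DERIV_isCont by blast
    then show ?thesis by (rule isCont_tendsto_compose[OF _ arg])
  qed
  have ends: "((?F \<circ> real_of_ereal) \<longlongrightarrow> 0) (at_right (ereal 0))"
    "((?F \<circ> real_of_ereal) \<longlongrightarrow> g n (s + \<phi> u)) (at_left (ereal u))"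
    unfolding ereal_tendsto_simps by (fact lim0 lim1)+
  have FTC: "set_integrable lborel (einterval (ereal 0) (ereal u)) ?f"
    "(LBINT v=ereal 0..ereal u. ?f v) = g n (s + \<phi> u) - 0"
    by (rule interval_integral_FTC_nonneg[OF _ _ _ _ ends];
        use u der cont nonneg in \<open>simp del: zero_ereal_def\<close>)+
  have "(\<integral>\<^sup>+v. ennreal (g_borel (Suc n) (s + phi_borel v)) * (ennreal (weight v) * indicator {..u} v) \<partial>lborel)
    = (\<integral>\<^sup>+v. ennreal (indicator {0<..<u} v *\<^sub>R ?f v) \<partial>lborel)"
  proof (rule nn_integral_cong_AE)
    \<comment> \<open>The two integrands differ at most at \<open>v = u\<close>.\<close>
    show "AE v in lborel. ennreal (g_borel (Suc n) (s + phi_borel v)) * (ennreal (weight v) * indicator {..u} v)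
        = ennreal (indicator {0<..<u} v *\<^sub>R ?f v)"
      using AE_lborel_singleton[of u]
    proof eventually_elim
      case (elim v)
      show ?case
      proof (cases "0 < v \<and> v < u")
        case True
        then have "g_borel (Suc n) (s + phi_borel v) = g (Suc n) (s + \<phi> v)" "weight v = 1 / g 1 (\<phi> v)"
          using pos[of v] u by (auto simp: g_borel_def phi_borel_def weight_def)
        moreover have "0 \<le> g (Suc n) (s + \<phi> v)" using True pos g_nonneg by blast
        ultimately show ?thesis
          using True weight_nonneg[of v] by (simp add: ennreal_mult[symmetric])
      next
        case False
        then show ?thesis using elim by (auto simp: weight_def indicator_def)
      qed
    qed
  qed
  also have "\<dots> = ennreal (\<integral>v. indicator {0<..<u} v *\<^sub>R ?f v \<partial>lborel)"
    using FTC(1) nonneg u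
    by (intro nn_integral_eq_integral) (auto simp: set_integrable_def ein indicator_def)
  also have "(\<integral>v. indicator {0<..<u} v *\<^sub>R ?f v \<partial>lborel) = g n (s + \<phi> u)"
    using FTC(2) u by (simp add: interval_lebesgue_integral_def set_lebesgue_integral_def ein)
  finally show ?thesis .
qed

text \<open>
  Each integration lowers the order of the derivative by one and replaces \<open>\<phi> (v j)\<close> by \<open>\<phi> (u j)\<close>. For
  the induction to go through, the order left over, \<open>m\<close>, and a shift \<open>s\<close> of the argument must be arbitrary:
  while the coordinates in \<open>J\<close> are integrated, the last coordinate \<open>y\<close> sits in the shift and one
  derivative is still in reserve. Then \<open>y < 1\<close> makes the shift positive, so the side condition holds.
\<close>

lemma integrate_all_coordinates:
  assumes "finite J" "\<And>j. j \<in> J \<Longrightarrow> 0 < u j \<and> u j \<le> 1" "0 \<le> s" "m = 0 \<or> 0 < s"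
  shows "(\<integral>\<^sup>+v. ennreal (g_borel (m + card J) (s + (\<Sum>j\<in>J. phi_borel (v j)))) *
      (\<Prod>j\<in>J. ennreal (weight (v j)) * indicator {..u j} (v j)) \<partial>Pi\<^sub>M J (\<lambda>_. lborel))
    = ennreal (g m (s + (\<Sum>j\<in>J. \<phi> (u j))))"
  using assms
proof (induction J arbitrary: m s rule: finite_induct)
  case empty
  interpret product_sigma_finite "\<lambda>_::'a. lborel :: real measure" ..
  have "g_borel m s = g m s" using empty by (intro g_borel_eq) auto
  then show ?case by (simp add: nn_integral_empty del: nn_integral_const)
next
  case (insert i J)
  interpret product_sigma_finite "\<lambda>_::'a. lborel :: real measure" ..
  let ?W = "\<lambda>j v. ennreal (weight v) * indicator {..u j} v :: ennreal"
  let ?c = "\<Sum>j\<in>J. \<phi> (u j)"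
  have c: "0 \<le> ?c" using insert gen_inv_nonneg by (auto intro!: sum_nonneg)
  have upd: "(\<Sum>j\<in>J. phi_borel ((v(i := y)) j)) = (\<Sum>j\<in>J. phi_borel (v j))"
    "(\<Prod>j\<in>J. ?W j ((v(i := y)) j)) = (\<Prod>j\<in>J. ?W j (v j))" for v y
    using insert.hyps by (auto intro!: sum.cong prod.cong)
  have split: "ennreal (g_borel (m + card (insert i J)) (s + (\<Sum>j\<in>insert i J. phi_borel ((v(i := y)) j)))) *
      (\<Prod>j\<in>insert i J. ?W j ((v(i := y)) j)) =
    ?W i y * (ennreal (g_borel (Suc m + card J) ((s + phi_borel y) + (\<Sum>j\<in>J. phi_borel (v j)))) *
      (\<Prod>j\<in>J. ?W j (v j)))" for v y
    unfolding sum.insert[OF insert.hyps] prod.insert[OF insert.hyps] upd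
      card_insert_disjoint[OF insert.hyps] by (simp add: ac_simps)
  have "(\<integral>\<^sup>+v. ennreal (g_borel (m + card (insert i J)) (s + (\<Sum>j\<in>insert i J. phi_borel (v j)))) *
      (\<Prod>j\<in>insert i J. ?W j (v j)) \<partial>Pi\<^sub>M (insert i J) (\<lambda>_. lborel)) =
    (\<integral>\<^sup>+y. \<integral>\<^sup>+v. ?W i y * (ennreal (g_borel (Suc m + card J) ((s + phi_borel y) + (\<Sum>j\<in>J. phi_borel (v j)))) *
      (\<Prod>j\<in>J. ?W j (v j))) \<partial>Pi\<^sub>M J (\<lambda>_. lborel) \<partial>lborel)"
    using insert.hyps
    by (subst product_nn_integral_insert_rev) (simp_all only: split, measurable)
  also have "\<dots> = (\<integral>\<^sup>+y. ennreal (g_borel (Suc m) ((s + ?c) + phi_borel y)) * ?W i y \<partial>lborel)"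
  proof (rule nn_integral_cong)
    fix y :: real
    show "(\<integral>\<^sup>+v. ?W i y * (ennreal (g_borel (Suc m + card J) ((s + phi_borel y) + (\<Sum>j\<in>J. phi_borel (v j)))) *
      (\<Prod>j\<in>J. ?W j (v j))) \<partial>Pi\<^sub>M J (\<lambda>_. lborel)) = ennreal (g_borel (Suc m) ((s + ?c) + phi_borel y)) * ?W i y"
    proof (cases "0 < y \<and> y < 1")
      case True
      then have "0 < phi_borel y" using gen_inv_pos[of y] by (simp add: phi_borel_def)
      then have pos: "0 < s + phi_borel y" using insert.prems by simp
      have "(\<integral>\<^sup>+v. ?W i y * (ennreal (g_borel (Suc m + card J) ((s + phi_borel y) + (\<Sum>j\<in>J. phi_borel (v j)))) *
        (\<Prod>j\<in>J. ?W j (v j))) \<partial>Pi\<^sub>M J (\<lambda>_. lborel)) =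
        ?W i y * (\<integral>\<^sup>+v. (ennreal (g_borel (Suc m + card J) ((s + phi_borel y) + (\<Sum>j\<in>J. phi_borel (v j)))) *
        (\<Prod>j\<in>J. ?W j (v j))) \<partial>Pi\<^sub>M J (\<lambda>_. lborel))"
        by (rule nn_integral_cmult) measurable
      also have "\<dots> = ?W i y * ennreal (g (Suc m) ((s + phi_borel y) + ?c))"
        using insert pos by (subst insert.IH) auto
      also have "g (Suc m) ((s + phi_borel y) + ?c) = g_borel (Suc m) ((s + ?c) + phi_borel y)"
        using pos c by (subst g_borel_eq) (auto simp: ac_simps)
      finally show ?thesis by (simp add: ac_simps)
    next
      case False
      then show ?thesis by (auto simp: weight_def)
    qed
  qed
  also have "\<dots> = ennreal (g m (s + ?c + \<phi> (u i)))"
    using insert.prems c by (intro integrate_one_coordinate) auto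
  finally show ?case using insert.hyps by (simp add: ac_simps)
qed

text \<open>
  On the faces of the cube where some coordinate is \<open>0\<close>, the copula vanishes because the generator is
  strict: it has no zero, so its extended inverse is infinite at \<open>0\<close>.
\<close>

lemma gen_inv_ext_0: "gen_inv_ext \<psi> 0 = \<infinity>"
proof -
  have "{t. 0 \<le> t \<and> \<psi> t = 0} = {}" using psi_pos by force
  then show ?thesis unfolding gen_inv_ext_def by (simp only: image_empty) (simp add: top_ereal_def)
qed

lemma arch_copula_positive:
  assumes "\<And>j. j \<in> {1..d} \<Longrightarrow> 0 < u j"
  shows "arch_copula d \<psi> u = \<psi> (gen_sum d \<psi> u)"
proof -
  have "(\<Sum>j = 1..d. gen_inv_ext \<psi> (u j)) = (\<Sum>j = 1..d. ereal (\<phi> (u j)))"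
    by (rule sum.cong[OF refl], use assms in \<open>force simp: gen_inv_ext_def\<close>)
  then show ?thesis by (simp add: arch_copula_def gen_ext_def gen_sum_def)
qed

lemma arch_copula_zero:
  assumes "j \<in> {1..d}" "u j = 0"
  shows "arch_copula d \<psi> u = 0"
proof -
  have "(\<Sum>j = 1..d. gen_inv_ext \<psi> (u j)) = \<infinity>"
    using assms gen_inv_ext_0 by (subst sum_Pinfty) (auto intro!: bexI[of _ j])
  then show ?thesis using tendsto_Lim[OF _ psi_at_top] by (simp add: arch_copula_def gen_ext_def)
qed

lemma density_eq_borel:
  assumes "v \<in> open_cube d"
  shows "g d (\<Sum>j = 1..d. \<phi> (v j)) * (\<Prod>j = 1..d. 1 / g 1 (\<phi> (v j)))
    = g_borel d (\<Sum>j = 1..d. phi_borel (v j)) * (\<Prod>j = 1..d. weight (v j))"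
proof -
  have v: "0 < v j" "v j < 1" if "j \<in> {1..d}" for j using assms that by (auto simp: PiE_iff)
  have "(\<Sum>j = 1..d. phi_borel (v j)) = (\<Sum>j = 1..d. \<phi> (v j))"
    using v by (intro sum.cong) (auto simp: phi_borel_def)
  moreover have "(\<Prod>j = 1..d. weight (v j)) = (\<Prod>j = 1..d. 1 / g 1 (\<phi> (v j)))"
    using v by (intro prod.cong) (auto simp: weight_def)
  moreover have "0 < (\<Sum>j = 1..d. \<phi> (v j)) \<or> d = 0 \<and> (\<Sum>j = 1..d. \<phi> (v j)) = 0"
    using v gen_inv_pos by (cases "d = 0") (auto intro!: sum_pos)
  ultimately show ?thesis using g_borel_eq by simp
qed

text \<open>
  In the pointwise formula the sign \<open>(- 1)\<^sup>d\<close> of the derivative of \<open>\<psi>\<close> cancels against the signs of the \<open>d\<close>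
  derivatives of \<open>\<phi>\<close>. The distribution function is \<open>integrate_all_coordinates\<close> with order \<open>m = 0\<close> and
  shift \<open>s = 0\<close>. What remains for a family is to compute \<open>g d\<close> at the sum and \<open>g 1\<close> at the inverse.
\<close>

theorem has_density:
  assumes c: "\<And>v. v \<in> open_cube d \<Longrightarrow>
    c v = g d (gen_sum d \<psi> v) * (\<Prod>j = 1..d. 1 / g 1 (\<phi> (v j)))"
  shows "arch_has_density d \<psi> c"
proof -
  let ?M = "Pi\<^sub>M {1..d} (\<lambda>_. lborel) :: (nat \<Rightarrow> real) measure"
  let ?f = "\<lambda>v. indicator (open_cube d) v * c v"
  let ?h = "\<lambda>v. g_borel d (\<Sum>j = 1..d. phi_borel (v j)) * (\<Prod>j = 1..d. weight (v j))"
  have f_eq: "?f v = ?h v" if "v \<in> space ?M" for v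
  proof (cases "v \<in> open_cube d")
    case True
    then show ?thesis using density_eq_borel c by (simp add: gen_sum_def)
  next
    case False
    moreover have "v \<in> extensional {1..d}" using that by (simp add: space_PiM PiE_def)
    ultimately obtain j where "j \<in> {1..d}" "v j \<notin> {0<..<1}"
      unfolding PiE_iff by blast
    then have "(\<Prod>j = 1..d. weight (v j)) = 0"
      by (intro prod_zero bexI[of _ j]) (auto simp: weight_def indicator_def)
    then show ?thesis using False by simp
  qed
  have h_nonneg: "0 \<le> ?h v" for v
    by (intro mult_nonneg_nonneg g_borel_nonneg prod_nonneg weight_nonneg)
  have h_measurable: "?h \<in> borel_measurable ?M" by measurable
  have meas: "?f \<in> borel_measurable ?M"
    using h_measurable f_eq by (subst measurable_cong[where g = ?h])
  have cdf: "emeasure (density ?M (\<lambda>v. ennreal (?f v))) (\<Pi>\<^sub>E j\<in>{1..d}. {..u j})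
      = ennreal (arch_copula d \<psi> u)" if u: "u \<in> closed_cube d" for u
  proof -
    have box: "(\<Pi>\<^sub>E j\<in>{1..d}. {..u j}) \<in> sets ?M"
      by (intro sets_PiM_I_finite) auto
    have ind: "indicator (\<Pi>\<^sub>E j\<in>{1..d}. {..u j}) v =
        (\<Prod>j = 1..d. indicator {..u j} (v j) :: ennreal)" if "v \<in> space ?M" for v
    proof (cases "v \<in> (\<Pi>\<^sub>E j\<in>{1..d}. {..u j})")
      case True
      then show ?thesis by (auto simp: PiE_iff indicator_def intro!: prod.neutral[symmetric])
    next
      case False
      moreover have "v \<in> extensional {1..d}" using that by (simp add: space_PiM PiE_def)
      ultimately obtain j where "j \<in> {1..d}" "v j \<notin> {..u j}"
        unfolding PiE_iff by blast
      then have "(\<Prod>j = 1..d. indicator {..u j} (v j) :: ennreal) = 0"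
        by (intro prod_zero bexI[of _ j]) auto
      then show ?thesis using False by simp
    qed
    have "emeasure (density ?M (\<lambda>v. ennreal (?f v))) (\<Pi>\<^sub>E j\<in>{1..d}. {..u j}) =
      (\<integral>\<^sup>+v. ennreal (?f v) * indicator (\<Pi>\<^sub>E j\<in>{1..d}. {..u j}) v \<partial>?M)"
      using meas box by (intro emeasure_density) auto
    also have "\<dots> = (\<integral>\<^sup>+v. ennreal (g_borel (0 + card {1..d}) (0 + (\<Sum>j\<in>{1..d}. phi_borel (v j)))) *
      (\<Prod>j\<in>{1..d}. ennreal (weight (v j)) * indicator {..u j} (v j)) \<partial>?M)"
    proof (rule nn_integral_cong)
      fix v assume v: "v \<in> space ?M"
      show "ennreal (?f v) * indicator (\<Pi>\<^sub>E j\<in>{1..d}. {..u j}) v =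
        ennreal (g_borel (0 + card {1..d}) (0 + (\<Sum>j\<in>{1..d}. phi_borel (v j)))) *
        (\<Prod>j\<in>{1..d}. ennreal (weight (v j)) * indicator {..u j} (v j))"
        unfolding f_eq[OF v] ind[OF v]
        by (simp add: ennreal_mult g_borel_nonneg prod_nonneg weight_nonneg prod_ennreal[symmetric]
            prod.distrib mult.assoc)
    qed
    also have "\<dots> = ennreal (arch_copula d \<psi> u)"
    proof (cases "\<forall>j\<in>{1..d}. 0 < u j")
      case True
      have "0 \<le> (\<Sum>j = 1..d. \<phi> (u j))"
        using True u by (intro sum_nonneg gen_inv_nonneg) (auto simp: PiE_iff)
      moreover have "arch_copula d \<psi> u = \<psi> (\<Sum>j = 1..d. \<phi> (u j))"
        using True by (subst arch_copula_positive) (simp_all add: gen_sum_def)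
      ultimately show ?thesis
        using True u by (subst integrate_all_coordinates) (auto simp: PiE_iff g_0)
    next
      case False
      then obtain i where i: "i \<in> {1..d}" "u i = 0"
        using u by (force simp: PiE_iff)
      have "(\<Prod>j\<in>{1..d}. ennreal (weight (v j)) * indicator {..u j} (v j)) = (0 :: ennreal)" for v
        using i by (auto simp: weight_def indicator_def intro!: prod_zero bexI[of _ i])
      note zero = this
      show ?thesis unfolding zero arch_copula_zero[of i d u, OF i] by simp
    qed
    finally show ?thesis .
  qed
  have nonneg: "0 \<le> c v" if "v \<in> open_cube d" for v
    using c[OF that] density_eq_borel[OF that] h_nonneg[of v] by (simp add: gen_sum_def)
  have pointwise: "c v = arch_density d \<psi> v" if v: "v \<in> open_cube d" for v
  proof (cases "d = 0")
    case True
    then show ?thesis using c[OF v] g_0 by (simp add: arch_density_def gen_sum_def)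
  next
    case False
    have v': "0 < v j" "v j < 1" if "j \<in> {1..d}" for j using v that by (auto simp: PiE_iff)
    have "0 < gen_sum d \<psi> v"
      unfolding gen_sum_def using v' gen_inv_pos False by (intro sum_pos) auto
    then have deriv_d: "(deriv ^^ d) \<psi> (gen_sum d \<psi> v) = (- 1) ^ d * g d (gen_sum d \<psi> v)"
      by (rule iterated_deriv_psi)
    let ?P = "\<Prod>j = 1..d. 1 / g 1 (\<phi> (v j))"
    have "(\<Prod>j = 1..d. deriv \<phi> (v j)) = (\<Prod>j = 1..d. - 1 * (1 / g 1 (\<phi> (v j))))"
      using v' by (intro prod.cong) (auto simp: DERIV_imp_deriv[OF gen_inv_deriv])
    also have "\<dots> = (- 1) ^ d * ?P"
      by (simp only: prod.distrib prod_constant) simp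
    finally have "arch_density d \<psi> v = ((- 1) ^ d * (- 1) ^ d) * (g d (gen_sum d \<psi> v) * ?P)"
      unfolding arch_density_def deriv_d by (simp only: ac_simps)
    moreover have "(- 1 :: real) ^ d * (- 1) ^ d = 1"
      by (simp flip: power_mult_distrib)
    ultimately show ?thesis using c[OF v] by (simp only: mult_1)
  qed
  show ?thesis
    unfolding arch_has_density_def is_lebesgue_density_def Let_def
  proof (intro conjI ballI allI impI)
    show "(deriv ^^ k) \<psi> differentiable (at t)" if "t > 0" for k t
      using iterated_deriv_psi(2)[OF that] real_differentiable_def by blast
    show "\<phi> differentiable (at x)" if "x \<in> {0<..<1}" for x
      using gen_inv_deriv[of x] that real_differentiable_def by auto
  qed (use meas nonneg cdf pointwise in auto)
qed

end

section \<open>Polylogarithms of negative integer order\<close>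

text \<open>
  The series of \<open>Li\<^sub>-\<^sub>n(z)\<close> divided by \<open>z\<close>. Dividing out \<open>z\<close> lets the Ali-Mikhail-Haq formula make sense at
  \<open>\<theta> = 0\<close>, where the argument of the polylogarithm vanishes.
\<close>

definition moment_series :: "nat \<Rightarrow> real \<Rightarrow> real" where
  "moment_series n z = (\<Sum>k. real (Suc k) ^ n * z ^ k)"

lemma diffs_moment: "diffs (\<lambda>k. real (Suc k) ^ n) k = real (Suc k) * real (Suc (Suc k)) ^ n"
  by (simp add: diffs_def)

lemma mult_diffs_moment:
  "z * (diffs (\<lambda>k. real (Suc k) ^ n) k * z ^ k) = real (Suc k) * real (Suc (Suc k)) ^ n * z ^ Suc k"
  by (simp only: diffs_moment power_Suc ac_simps)

lemma moment_step: "real (Suc k) ^ Suc n * z ^ k = real (Suc k) ^ n * z ^ k + real k * real (Suc k) ^ n * z ^ k"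
  by (simp add: algebra_simps)

text \<open>
  The series of order \<open>n + 1\<close> is the series of order \<open>n\<close> plus \<open>z\<close> times its termwise derivative, and
  termwise differentiation preserves convergence on the unit disc.
\<close>

lemma summable_moment_series:
  assumes "\<bar>z\<bar> < 1"
  shows "summable (\<lambda>k. real (Suc k) ^ n * z ^ k)"
    and "summable (\<lambda>k. real k * real (Suc k) ^ n * z ^ k)"
proof -
  have step: "summable (\<lambda>k. real k * real (Suc k) ^ n * z ^ k)"
    if "\<And>x. \<bar>x\<bar> < 1 \<Longrightarrow> summable (\<lambda>k. real (Suc k) ^ n * x ^ k)" "\<bar>z\<bar> < 1" for n and z :: real
  proof -
    have "summable (\<lambda>k. diffs (\<lambda>k. real (Suc k) ^ n) k * z ^ k)"
      by (rule termdiff_converges[where K = 1]) (use that in auto)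
    from summable_mult[OF this, of z]
    have "summable (\<lambda>k. real (Suc k) * real (Suc (Suc k)) ^ n * z ^ Suc k)"
      by (simp only: mult_diffs_moment)
    then show ?thesis
      using summable_Suc_iff[of "\<lambda>k. real k * real (Suc k) ^ n * z ^ k"] by blast
  qed
  have all: "summable (\<lambda>k. real (Suc k) ^ n * z ^ k)" if "\<bar>z\<bar> < 1" for n and z :: real
    using that
  proof (induction n arbitrary: z)
    case 0
    then show ?case by (simp add: summable_geometric)
  next
    case (Suc n)
    show ?case unfolding moment_step
      by (rule summable_add[OF Suc.IH[OF Suc.prems] step[OF Suc.IH Suc.prems]])
  qed
  show "summable (\<lambda>k. real (Suc k) ^ n * z ^ k)" by (rule all[OF assms])
  show "summable (\<lambda>k. real k * real (Suc k) ^ n * z ^ k)" by (rule step[OF all assms])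
qed

text \<open>
  This is \<open>z (Li\<^sub>-\<^sub>n)' = Li\<^sub>-\<^sub>n\<^sub>-\<^sub>1\<close> after division by \<open>z\<close>.
\<close>

lemma moment_series_deriv:
  assumes "\<bar>z\<bar> < 1"
  obtains D where "(moment_series n has_real_derivative D) (at z)"
    and "moment_series n z + z * D = moment_series (Suc n) z"
proof
  let ?D = "\<Sum>k. diffs (\<lambda>k. real (Suc k) ^ n) k * z ^ k"
  show "(moment_series n has_real_derivative ?D) (at z)"
    unfolding moment_series_def[abs_def]
    by (rule termdiffs_strong'[where K = 1]) (use assms summable_moment_series in auto)
  have "summable (\<lambda>k. diffs (\<lambda>k. real (Suc k) ^ n) k * z ^ k)"
    by (rule termdiff_converges[where K = 1]) (use assms summable_moment_series in auto)
  then have "z * ?D = (\<Sum>k. real (Suc k) * real (Suc (Suc k)) ^ n * z ^ Suc k)"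
    by (simp only: suminf_mult[symmetric] mult_diffs_moment)
  also have "\<dots> = (\<Sum>k. real k * real (Suc k) ^ n * z ^ k)"
    using suminf_split_head[OF summable_moment_series(2)[OF assms]] by simp
  finally show "moment_series n z + z * ?D = moment_series (Suc n) z"
    unfolding moment_series_def moment_step
    using suminf_add[OF summable_moment_series[OF assms]] by simp
qed

lemma moment_series_nonneg:
  assumes "0 \<le> z" "z < 1"
  shows "0 \<le> moment_series n z"
  unfolding moment_series_def
  by (rule suminf_nonneg) (use assms summable_moment_series in auto)

lemma moment_series_0: "\<bar>z\<bar> < 1 \<Longrightarrow> moment_series 0 z = 1 / (1 - z)"
  by (simp add: moment_series_def suminf_geometric)

lemma moment_series_1: "\<bar>z\<bar> < 1 \<Longrightarrow> moment_series (Suc 0) z = 1 / (1 - z)\<^sup>2"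
  using sums_unique[OF geometric_deriv_sums[of z]] by (simp add: moment_series_def)

lemma polylog_moment_series:
  assumes "\<bar>z\<bar> < 1"
  shows "polylog (- real n) z = z * moment_series n z"
proof -
  have "z ^ Suc k / real (Suc k) powr (- real n) = z * (real (Suc k) ^ n * z ^ k)" for k
    by (simp add: powr_minus powr_realpow divide_inverse ac_simps del: of_nat_Suc)
  then show ?thesis
    unfolding polylog_def moment_series_def
    using suminf_mult[OF summable_moment_series(1)[OF assms], of z] by simp
qed

text \<open>
  For \<open>c \<noteq> 0\<close> this is \<open>Li\<^sub>-\<^sub>n(c e\<^sup>-\<^sup>t) / c\<close>. Differentiation in \<open>t\<close> raises \<open>n\<close> and changes the sign, so these
  functions are completely monotone; they supply all derivatives of the Ali-Mikhail-Haq and Frank generators.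
\<close>

definition exp_series :: "nat \<Rightarrow> real \<Rightarrow> real \<Rightarrow> real" where
  "exp_series n c t = exp (- t) * moment_series n (c * exp (- t))"

lemma mult_exp_bound:
  fixes c t :: real
  assumes "0 \<le> c" "c < 1" "0 \<le> t"
  shows "0 \<le> c * exp (- t)" "c * exp (- t) < 1"
proof -
  have "c * exp (- t) \<le> c * 1" using assms by (intro mult_left_mono) auto
  then show "0 \<le> c * exp (- t)" "c * exp (- t) < 1" using assms by auto
qed

lemma exp_series_deriv:
  assumes "0 \<le> c" "c < 1" "0 \<le> t"
  shows "(exp_series n c has_real_derivative - exp_series (Suc n) c t) (at t)"
proof -
  have "\<bar>c * exp (- t)\<bar> < 1" using mult_exp_bound[OF assms] by simp
  then obtain D where D: "(moment_series n has_real_derivative D) (at (c * exp (- t)))"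
    "moment_series n (c * exp (- t)) + (c * exp (- t)) * D = moment_series (Suc n) (c * exp (- t))"
    by (rule moment_series_deriv)
  have "((\<lambda>t. c * exp (- t)) has_real_derivative - (c * exp (- t))) (at t)"
    by (auto intro!: derivative_eq_intros)
  from DERIV_chain2[where f = "moment_series n" and g = "\<lambda>t. c * exp (- t)", OF D(1) this]
  have "((\<lambda>t. exp (- t) * moment_series n (c * exp (- t))) has_real_derivative
      - exp (- t) * moment_series n (c * exp (- t)) + D * - (c * exp (- t)) * exp (- t)) (at t)"
    by (intro DERIV_mult) (auto intro!: derivative_eq_intros)
  also have "- exp (- t) * moment_series n (c * exp (- t)) + D * - (c * exp (- t)) * exp (- t)
      = - exp_series (Suc n) c t"
    unfolding exp_series_def D(2)[symmetric] by (simp add: algebra_simps)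
  finally show ?thesis unfolding exp_series_def[abs_def] .
qed

lemma exp_series_nonneg: "0 \<le> c \<Longrightarrow> c < 1 \<Longrightarrow> 0 \<le> t \<Longrightarrow> 0 \<le> exp_series n c t"
  using mult_exp_bound moment_series_nonneg by (simp add: exp_series_def)

section \<open>The Ali-Mikhail-Haq family\<close>

definition amh_factor :: "real \<Rightarrow> real \<Rightarrow> real" where
  "amh_factor \<theta> u = u / (1 - \<theta> * (1 - u))"

text \<open>
  The Ali-Mikhail-Haq density with the factor \<open>\<theta>\<^sup>2\<close> cancelled. It is continuous in \<open>\<theta>\<close> at \<open>0\<close>, so its value
  there is the limit of the densities.
\<close>

definition amh_density_ext :: "nat \<Rightarrow> real \<Rightarrow> (nat \<Rightarrow> real) \<Rightarrow> real" where
  "amh_density_ext d \<theta> u =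
     (1 - \<theta>) ^ (d + 1) * (\<Prod>j = 1..d. amh_factor \<theta> (u j))\<^sup>2 / (\<Prod>j = 1..d. (u j)\<^sup>2) *
     moment_series d (\<theta> * (\<Prod>j = 1..d. amh_factor \<theta> (u j)))"

lemma amh_denominator_pos:
  fixes \<theta> u :: real
  assumes "0 \<le> \<theta>" "\<theta> < 1" "0 < u" "u < 1"
  shows "0 < 1 - \<theta> * (1 - u)" "u \<le> 1 - \<theta> * (1 - u)"
proof -
  show "u \<le> 1 - \<theta> * (1 - u)"
    using mult_right_mono[of \<theta> 1 "1 - u"] assms by (simp add: algebra_simps)
  then show "0 < 1 - \<theta> * (1 - u)" using assms by linarith
qed

lemma cm_generator_amh:
  assumes "0 \<le> \<theta>" "\<theta> < 1"
  shows "cm_generator (amh_gen \<theta>) (\<lambda>n t. (1 - \<theta>) * exp_series n \<theta> t)"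
proof
  show "(1 - \<theta>) * exp_series 0 \<theta> t = amh_gen \<theta> t" if "0 \<le> t" for t
  proof -
    have "exp t \<noteq> \<theta>" using that assms one_le_exp_iff[of t] by linarith
    then show ?thesis
      using mult_exp_bound[OF assms that]
      by (simp add: exp_series_def moment_series_0 amh_gen_def exp_minus field_simps)
  qed
  show "amh_gen \<theta> 0 = 1" using assms by (simp add: amh_gen_def)
  have "(amh_gen \<theta> \<longlongrightarrow> (1 - \<theta>) / (exp 0 - \<theta>)) (at_right 0)"
    unfolding amh_gen_def[abs_def] using assms by (intro tendsto_intros) auto
  then show "(amh_gen \<theta> \<longlongrightarrow> 1) (at_right 0)" using assms by simp
  show "(amh_gen \<theta> \<longlongrightarrow> 0) at_top"
    unfolding amh_gen_def[abs_def]
    by (intro tendsto_divide_0[OF tendsto_const] filterlim_at_top_imp_at_infinity)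
      (use filterlim_tendsto_add_at_top[OF tendsto_const exp_at_top, of "- \<theta>"] in simp)
  show "((\<lambda>t. (1 - \<theta>) * exp_series n \<theta> t) has_real_derivative
      - ((1 - \<theta>) * exp_series (Suc n) \<theta> t)) (at t)" if "0 < t" for n t
    using DERIV_cmult[OF exp_series_deriv[OF assms, of t n], of "1 - \<theta>"] that by simp
  show "0 \<le> (1 - \<theta>) * exp_series n \<theta> t" if "0 < t" for n t
    using exp_series_nonneg[OF assms, of t] that assms by simp
  show "0 < (1 - \<theta>) * exp_series 1 \<theta> t" if "0 < t" for t
    using mult_exp_bound[OF assms, of t] that assms by (simp add: exp_series_def moment_series_1)
qed

text \<open>
  The case \<open>\<theta> = 0\<close> is included: the generator is then \<open>exp (- t)\<close> and no step divides by \<open>\<theta>\<close>.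
\<close>

lemma amh_has_density_ext:
  assumes "0 \<le> \<theta>" "\<theta> < 1"
    and c: "\<And>u. u \<in> open_cube d \<Longrightarrow> c u = amh_density_ext d \<theta> u"
  shows "arch_has_density d (amh_gen \<theta>) c"
proof -
  interpret cm_generator "amh_gen \<theta>" "\<lambda>n t. (1 - \<theta>) * exp_series n \<theta> t"
    by (rule cm_generator_amh[OF assms(1,2)])
  have inv: "exp (- \<phi> u) = amh_factor \<theta> u"
    "1 / ((1 - \<theta>) * exp_series 1 \<theta> (\<phi> u)) = (1 - \<theta>) * amh_factor \<theta> u / u\<^sup>2"
    if u: "0 < u" "u < 1" for u
  proof -
    note den = amh_denominator_pos[OF assms(1,2) u]
    let ?t = "ln ((1 - \<theta> * (1 - u)) / u)"
    have t: "0 \<le> ?t" "exp ?t = (1 - \<theta> * (1 - u)) / u" using den u by auto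
    have "amh_gen \<theta> ?t = u"
      unfolding amh_gen_def t(2) using u assms by (simp add: field_simps)
    then have phi: "\<phi> u = ?t" using t(1) by (intro gen_inv_eq)
    show x: "exp (- \<phi> u) = amh_factor \<theta> u"
      unfolding phi exp_minus t(2) by (simp add: amh_factor_def)
    define w where "w = 1 - \<theta> * (1 - u)"
    have w: "0 < w" "amh_factor \<theta> u = u / w" using den by (auto simp: w_def amh_factor_def)
    have rest: "1 - \<theta> * u / w = (1 - \<theta>) / w"
      using w(1) by (simp add: field_simps) (simp add: w_def algebra_simps)
    have "\<bar>\<theta> * (u / w)\<bar> < 1"
      using mult_exp_bound[OF assms(1,2), of "\<phi> u"] t(1) unfolding x w(2) phi[symmetric] by simp
    then have "exp_series 1 \<theta> (\<phi> u) = u / w / ((1 - \<theta>) / w)\<^sup>2"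
      by (simp add: exp_series_def x w(2) moment_series_1 rest)
    then show "1 / ((1 - \<theta>) * exp_series 1 \<theta> (\<phi> u)) = (1 - \<theta>) * amh_factor \<theta> u / u\<^sup>2"
      using w(1) u assms(2) unfolding w(2) by (simp add: field_simps power2_eq_square)
  qed
  show ?thesis
  proof (rule has_density)
    fix u assume u: "u \<in> open_cube d"
    note u' = open_cubeD[OF u]
    have "exp (- gen_sum d (amh_gen \<theta>) u) = (\<Prod>j = 1..d. amh_factor \<theta> (u j))"
      unfolding gen_sum_def sum_negf[symmetric] exp_sum[OF finite_atLeastAtMost]
      using inv(1) u' by (intro prod.cong) auto
    moreover have "(\<Prod>j = 1..d. 1 / ((1 - \<theta>) * exp_series 1 \<theta> (\<phi> (u j)))) =
        (\<Prod>j = 1..d. (1 - \<theta>) * amh_factor \<theta> (u j) / (u j)\<^sup>2)"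
      using inv(2) u' by (intro prod.cong) auto
    ultimately show "c u = (1 - \<theta>) * exp_series d \<theta> (gen_sum d (amh_gen \<theta>) u) *
        (\<Prod>j = 1..d. 1 / ((1 - \<theta>) * exp_series 1 \<theta> (\<phi> (u j))))"
      unfolding c[OF u] amh_density_ext_def
      by (simp add: exp_series_def prod.distrib prod_dividef power2_eq_square)
  qed
qed

lemma amh_density_eq_ext:
  assumes "0 < \<theta>" "\<theta> < 1" "u \<in> open_cube d"
  shows "amh_density d \<theta> u = amh_density_ext d \<theta> u"
proof -
  let ?q = "\<Prod>j = 1..d. amh_factor \<theta> (u j)"
  have factor: "0 \<le> amh_factor \<theta> (u j)" "amh_factor \<theta> (u j) \<le> 1" if "j \<in> {1..d}" for j
    using amh_denominator_pos[of \<theta> "u j"] assms open_cubeD[OF assms(3) that]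
    by (auto simp: amh_factor_def)
  have "0 \<le> ?q" "?q \<le> 1" using factor by (auto intro!: prod_nonneg prod_le_1)
  then have "0 \<le> \<theta> * ?q" "\<theta> * ?q \<le> \<theta> * 1" using assms by (auto intro: mult_left_mono)
  then have "\<bar>\<theta> * ?q\<bar> < 1" using assms by linarith
  moreover have "amh_h d \<theta> u = \<theta> * ?q" by (simp add: amh_h_def amh_factor_def)
  ultimately show ?thesis
    unfolding amh_density_def amh_density_ext_def
    using assms by (simp add: polylog_moment_series power2_eq_square)
qed

lemma amh_density_limit:
  assumes "u \<in> open_cube d"
  shows "((\<lambda>\<theta>. amh_density d \<theta> u) \<longlongrightarrow> amh_density_ext d 0 u) (at_right 0)"
proof -
  have factor: "((\<lambda>\<theta>. \<Prod>j = 1..d. amh_factor \<theta> (u j)) \<longlongrightarrow> (\<Prod>j = 1..d. amh_factor 0 (u j))) (at_right 0)"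
    unfolding amh_factor_def by (intro tendsto_intros) auto
  obtain D where "(moment_series d has_real_derivative D) (at 0)"
    by (rule moment_series_deriv[of 0 d]) auto
  then have cont: "isCont (moment_series d) (0 * (\<Prod>j = 1..d. amh_factor 0 (u j)))"
    using DERIV_isCont by fastforce
  have series: "((\<lambda>\<theta>. moment_series d (\<theta> * (\<Prod>j = 1..d. amh_factor \<theta> (u j)))) \<longlongrightarrow>
      moment_series d (0 * (\<Prod>j = 1..d. amh_factor 0 (u j)))) (at_right 0)"
    by (rule isCont_tendsto_compose[OF cont tendsto_mult[OF tendsto_ident_at factor]])
  have "((\<lambda>\<theta>. amh_density_ext d \<theta> u) \<longlongrightarrow> amh_density_ext d 0 u) (at_right 0)"
    unfolding amh_density_ext_def
  proof (rule tendsto_mult[OF tendsto_divide[OF tendsto_mult[OF _ tendsto_power[OF factor]] tendsto_const] series])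
    show "((\<lambda>\<theta>. (1 - \<theta>) ^ (d + 1)) \<longlongrightarrow> (1 - 0) ^ (d + 1)) (at_right (0::real))"
      by (intro tendsto_intros)
    show "(\<Prod>j = 1..d. (u j)\<^sup>2) \<noteq> 0"
      using open_cubeD[OF assms] by force
  qed
  moreover have "eventually (\<lambda>\<theta>. amh_density_ext d \<theta> u = amh_density d \<theta> u) (at_right 0)"
    by (rule eventually_at_rightI[of 0 1]) (use amh_density_eq_ext[OF _ _ assms] in auto)
  ultimately show ?thesis by (rule Lim_transform_eventually)
qed

section \<open>The Frank family\<close>

text \<open>
  The generator is \<open>Li\<^sub>1(p e\<^sup>-\<^sup>t) / \<theta>\<close> with \<open>p = 1 - e\<^sup>-\<^sup>\<theta>\<close>, so every differentiation lowers the order of the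
  polylogarithm by one, starting with order \<open>0\<close> for the first derivative.
\<close>

definition frank_cm :: "real \<Rightarrow> nat \<Rightarrow> real \<Rightarrow> real" where
  "frank_cm \<theta> n t = (case n of 0 \<Rightarrow> frank_gen \<theta> t
     | Suc m \<Rightarrow> (1 - exp (- \<theta>)) / \<theta> * exp_series m (1 - exp (- \<theta>)) t)"

lemma cm_generator_frank:
  assumes \<theta>: "0 < \<theta>"
  shows "cm_generator (frank_gen \<theta>) (frank_cm \<theta>)"
proof
  define p where "p = 1 - exp (- \<theta>)"
  have p: "0 \<le> p" "p < 1" "0 < p" "ln (1 - p) = - \<theta>" using \<theta> by (auto simp: p_def)
  have gen: "frank_gen \<theta> t = - ln (1 - p * exp (- t)) / \<theta>" for t
    by (simp add: frank_gen_def p_def)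
  have cm: "frank_cm \<theta> 0 t = frank_gen \<theta> t" "frank_cm \<theta> (Suc m) t = p / \<theta> * exp_series m p t" for m t
    by (auto simp: frank_cm_def p_def)
  show "frank_cm \<theta> 0 t = frank_gen \<theta> t" for t by (rule cm)
  show "frank_gen \<theta> 0 = 1" using \<theta> p by (simp add: gen)
  have "(frank_gen \<theta> \<longlongrightarrow> - ln (1 - p * exp (- 0)) / \<theta>) (at_right 0)"
    unfolding gen[abs_def] using \<theta> p by (intro tendsto_intros) auto
  then show "(frank_gen \<theta> \<longlongrightarrow> 1) (at_right 0)" using \<theta> p by simp
  have "((\<lambda>t. exp (- t :: real)) \<longlongrightarrow> 0) at_top"
    by (rule filterlim_compose[OF exp_at_bot filterlim_uminus_at_bot_at_top])
  then have "(frank_gen \<theta> \<longlongrightarrow> - ln (1 - p * 0) / \<theta>) at_top"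
    unfolding gen[abs_def] using \<theta> by (intro tendsto_intros) auto
  then show "(frank_gen \<theta> \<longlongrightarrow> 0) at_top" by simp
  show "(frank_cm \<theta> n has_real_derivative - frank_cm \<theta> (Suc n) t) (at t)" if t: "0 < t" for n t
  proof (cases n)
    case 0
    have bound: "0 \<le> p * exp (- t)" "p * exp (- t) < 1" using mult_exp_bound[OF p(1,2), of t] t by auto
    have "((\<lambda>t. 1 - p * exp (- t)) has_real_derivative p * exp (- t)) (at t)"
      by (auto intro!: derivative_eq_intros)
    from DERIV_cdivide[OF DERIV_minus[OF DERIV_chain2[OF DERIV_ln_divide this]], of \<theta>]
    have "(frank_gen \<theta> has_real_derivative - (1 / (1 - p * exp (- t)) * (p * exp (- t))) / \<theta>) (at t)"
      using bound unfolding gen[abs_def] by simp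
    then show ?thesis
      using 0 bound by (simp add: cm[abs_def] exp_series_def moment_series_0 mult.commute)
  next
    case (Suc m)
    then show ?thesis
      using DERIV_cmult[OF exp_series_deriv[OF p(1,2), of t m], of "p / \<theta>"] t
      by (simp add: cm[abs_def])
  qed
  show "0 \<le> frank_cm \<theta> n t" if t: "0 < t" for n t
  proof (cases n)
    case 0
    have "ln (1 - p * exp (- t)) \<le> 0"
      using mult_exp_bound[OF p(1,2), of t] t by (subst ln_le_zero_iff) auto
    then show ?thesis using 0 \<theta> by (simp add: cm gen divide_nonpos_pos)
  next
    case (Suc m)
    then show ?thesis using \<theta> p t exp_series_nonneg[OF p(1,2), of t] by (simp add: cm)
  qed
  show "0 < frank_cm \<theta> 1 t" if t: "0 < t" for t
    using mult_exp_bound[OF p(1,2), of t] t \<theta> p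
    by (simp add: cm exp_series_def moment_series_0)
qed

lemma frank_has_density:
  assumes \<theta>: "0 < \<theta>" and d: "1 \<le> d"
  shows "arch_has_density d (frank_gen \<theta>) (frank_density d \<theta>)"
proof -
  interpret cm_generator "frank_gen \<theta>" "frank_cm \<theta>"
    by (rule cm_generator_frank[OF \<theta>])
  define p where "p = 1 - exp (- \<theta>)"
  have p: "0 < p" "p < 1" using \<theta> by (auto simp: p_def)
  obtain m where m: "d = Suc m" using d by (cases d) auto
  have inv: "exp (- \<phi> u) = (1 - exp (- \<theta> * u)) / p"
    "1 / frank_cm \<theta> 1 (\<phi> u) = \<theta> * exp (- \<theta> * u) / (1 - exp (- \<theta> * u))"
    if u: "0 < u" "u < 1" for u
  proof -
    let ?y = "1 - exp (- \<theta> * u)"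
    have y: "0 < ?y" "?y \<le> p" using u \<theta> by (auto simp: p_def)
    let ?t = "- ln (?y / p)"
    have t: "0 \<le> ?t" "exp (- ?t) = ?y / p" using y p by auto
    have "frank_gen \<theta> ?t = u"
      unfolding frank_gen_def t(2) p_def[symmetric] using p \<theta> by simp
    then have phi: "\<phi> u = ?t" using t(1) by (intro gen_inv_eq)
    show x: "exp (- \<phi> u) = ?y / p" unfolding phi t(2) ..
    have "moment_series 0 ?y = 1 / (1 - ?y)" using y by (intro moment_series_0) auto
    then show "1 / frank_cm \<theta> 1 (\<phi> u) = \<theta> * exp (- \<theta> * u) / ?y"
      using p by (simp add: frank_cm_def exp_series_def x p_def[symmetric])
  qed
  show ?thesis
  proof (rule has_density)
    fix u assume u: "u \<in> open_cube d"
    note u' = open_cubeD[OF u]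
    define Y where "Y = (\<Prod>j = 1..d. 1 - exp (- \<theta> * u j))"
    let ?h = "frank_h d \<theta> u" and ?T = "gen_sum d (frank_gen \<theta>) u"
    have Y: "0 < Y" unfolding Y_def using u' \<theta> by (intro prod_pos) auto
    have h: "?h = p * (Y / p ^ d)"
      using p by (simp add: frank_h_def p_def[symmetric] Y_def power_int_diff)
    then have Y_h: "Y = ?h * p ^ m" using p by (simp add: m)
    have "Y / p ^ d = (\<Prod>j = 1..d. (1 - exp (- \<theta> * u j)) / p)"
      by (simp add: Y_def prod_dividef)
    also have "\<dots> = (\<Prod>j = 1..d. exp (- \<phi> (u j)))"
      using inv(1) u' by (intro prod.cong) auto
    also have "\<dots> = exp (- ?T)"
      unfolding gen_sum_def sum_negf[symmetric] exp_sum[OF finite_atLeastAtMost] ..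
    finally have T: "p * exp (- ?T) = ?h" by (simp add: h)
    have "0 \<le> ?T"
      unfolding gen_sum_def using u' by (intro sum_nonneg gen_inv_nonneg) force+
    then have "0 \<le> ?h" "?h < 1"
      using mult_exp_bound[of p ?T] p unfolding T by simp_all
    then have "\<bar>?h\<bar> < 1" by simp
    then have polylog: "polylog (- (real d - 1)) ?h = ?h * moment_series m ?h"
      using polylog_moment_series[of ?h m] by (simp add: m)
    have "(\<Prod>j = 1..d. 1 / frank_cm \<theta> 1 (\<phi> (u j))) =
        (\<Prod>j = 1..d. \<theta> * exp (- \<theta> * u j) / (1 - exp (- \<theta> * u j)))"
      using inv(2) u' by (intro prod.cong) auto
    also have "\<dots> = \<theta> ^ d * exp (- \<theta> * (\<Sum>j = 1..d. u j)) / Y"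
      by (simp add: Y_def prod.distrib prod_dividef exp_sum sum_distrib_left)
    finally have jacobian: "(\<Prod>j = 1..d. 1 / frank_cm \<theta> 1 (\<phi> (u j))) =
      \<theta> ^ d * exp (- \<theta> * (\<Sum>j = 1..d. u j)) / Y" .
    have "frank_cm \<theta> d ?T = p * exp (- ?T) / \<theta> * moment_series m (p * exp (- ?T))"
      by (simp add: frank_cm_def m exp_series_def p_def)
    then have deriv: "frank_cm \<theta> d ?T = ?h / \<theta> * moment_series m ?h" unfolding T .
    define e where "e = exp (- \<theta> * (\<Sum>j = 1..d. u j))"
    have "0 < ?h" using Y p h by simp
    then show "frank_density d \<theta> u = frank_cm \<theta> d ?T * (\<Prod>j = 1..d. 1 / frank_cm \<theta> 1 (\<phi> (u j)))"
      unfolding frank_density_def jacobian deriv polylog Y_h p_def[symmetric] e_def[symmetric]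
      using p \<theta> by (simp add: m power_divide)
  qed
qed

section \<open>The Clayton family\<close>

definition clayton_cm :: "real \<Rightarrow> nat \<Rightarrow> real \<Rightarrow> real" where
  "clayton_cm \<theta> n t = (\<Prod>k<n. 1 / \<theta> + real k) * (1 + t) powr (- (real n + 1 / \<theta>))"

lemma cm_generator_clayton:
  assumes \<theta>: "0 < \<theta>"
  shows "cm_generator (clayton_gen \<theta>) (clayton_cm \<theta>)"
proof
  show "clayton_cm \<theta> 0 t = clayton_gen \<theta> t" for t
    by (simp add: clayton_cm_def clayton_gen_def)
  show "clayton_gen \<theta> 0 = 1" by (simp add: clayton_gen_def)
  have "(clayton_gen \<theta> \<longlongrightarrow> (1 + 0) powr (- 1 / \<theta>)) (at_right 0)"
    unfolding clayton_gen_def[abs_def] by (intro tendsto_intros) auto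
  then show "(clayton_gen \<theta> \<longlongrightarrow> 1) (at_right 0)" by simp
  show "(clayton_gen \<theta> \<longlongrightarrow> 0) at_top"
    unfolding clayton_gen_def[abs_def]
    by (rule tendsto_neg_powr[OF _ filterlim_tendsto_add_at_top[OF tendsto_const filterlim_ident]])
      (use \<theta> in auto)
  show "(clayton_cm \<theta> n has_real_derivative - clayton_cm \<theta> (Suc n) t) (at t)" if "0 < t" for n t
  proof -
    define a where "a = - (real n + 1 / \<theta>)"
    have "((\<lambda>t. (1 + t) powr a) has_real_derivative a * (1 + t) powr (a - 1)) (at t)"
      using that by (auto intro!: derivative_eq_intros)
    from DERIV_cmult[OF this, of "\<Prod>k<n. 1 / \<theta> + real k"]
    have "(clayton_cm \<theta> n has_real_derivative
        (\<Prod>k<n. 1 / \<theta> + real k) * (a * (1 + t) powr (a - 1))) (at t)"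
      unfolding clayton_cm_def[abs_def] a_def .
    moreover have "- (real (Suc n) + 1 / \<theta>) = a - 1" "1 / \<theta> + real n = - a"
      by (auto simp: a_def)
    ultimately show ?thesis by (simp only: clayton_cm_def prod.lessThan_Suc) (simp add: mult.assoc)
  qed
  show "0 \<le> clayton_cm \<theta> n t" for n t
    using \<theta> by (auto simp: clayton_cm_def intro!: mult_nonneg_nonneg prod_nonneg)
  show "0 < clayton_cm \<theta> 1 t" if "0 < t" for t
    using \<theta> that by (simp add: clayton_cm_def)
qed

lemma clayton_has_density:
  assumes \<theta>: "0 < \<theta>"
  shows "arch_has_density d (clayton_gen \<theta>) (clayton_density d \<theta>)"
proof -
  interpret cm_generator "clayton_gen \<theta>" "clayton_cm \<theta>"
    by (rule cm_generator_clayton[OF \<theta>])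
  have inv: "1 / clayton_cm \<theta> 1 (\<phi> u) = \<theta> * u powr (- (1 + \<theta>))" if u: "0 < u" "u < 1" for u
  proof -
    have t: "0 \<le> u powr (- \<theta>) - 1"
      using powr_mono_both'[of u u 0 "- \<theta>"] u \<theta> powr_mono'[of "- \<theta>" 0 u] by simp
    moreover have "clayton_gen \<theta> (u powr (- \<theta>) - 1) = u"
      using u \<theta> by (simp add: clayton_gen_def powr_powr)
    ultimately have "\<phi> u = u powr (- \<theta>) - 1" by (intro gen_inv_eq)
    moreover have "- \<theta> * (- (1 + 1 / \<theta>)) = 1 + \<theta>" using \<theta> by (simp add: field_simps)
    ultimately have "clayton_cm \<theta> 1 (\<phi> u) = 1 / \<theta> * u powr (1 + \<theta>)"
      by (simp add: clayton_cm_def powr_powr)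
    then show ?thesis by (simp only: powr_minus) (simp add: field_simps)
  qed
  show ?thesis
  proof (rule has_density)
    fix u assume u: "u \<in> open_cube d"
    note u' = open_cubeD[OF u]
    have "(\<Prod>j = 1..d. 1 / clayton_cm \<theta> 1 (\<phi> (u j))) = (\<Prod>j = 1..d. \<theta> * u j powr (- (1 + \<theta>)))"
      using inv u' by (intro prod.cong) auto
    also have "\<dots> = \<theta> ^ d * (\<Prod>j = 1..d. u j) powr (- (1 + \<theta>))"
      by (subst prod_powr_distrib) (simp add: prod.distrib)
    finally have jacobian: "(\<Prod>j = 1..d. 1 / clayton_cm \<theta> 1 (\<phi> (u j))) =
        \<theta> ^ d * (\<Prod>j = 1..d. u j) powr (- (1 + \<theta>))" .
    have "(\<Prod>k<d. 1 / \<theta> + real k) * \<theta> ^ d = (\<Prod>k<d. (1 / \<theta> + real k) * \<theta>)"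
      by (simp add: prod.distrib)
    also have "\<dots> = (\<Prod>k<d. \<theta> * real k + 1)"
      using \<theta> by (intro prod.cong) (auto simp: field_simps)
    finally have const: "(\<Prod>k<d. 1 / \<theta> + real k) * \<theta> ^ d = (\<Prod>k<d. \<theta> * real k + 1)" .
    show "clayton_density d \<theta> u = clayton_cm \<theta> d (gen_sum d (clayton_gen \<theta>) u) *
        (\<Prod>j = 1..d. 1 / clayton_cm \<theta> 1 (\<phi> (u j)))"
      unfolding jacobian clayton_density_def const[symmetric]
      unfolding clayton_cm_def by (simp only: ac_simps)
  qed
qed

section \<open>The Gumbel family\<close>

lemma signed_stirling_0: "signed_stirling (Suc n) 0 = 0"
  "real n * signed_stirling n 0 = 0"
  by (cases n; simp add: signed_stirling_def)+

lemma signed_stirling_eq_0: "n < j \<Longrightarrow> signed_stirling n j = 0"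
  by (simp add: signed_stirling_def)

lemma signed_stirling_Suc:
  "signed_stirling (Suc n) (Suc j) = signed_stirling n j - real n * signed_stirling n (Suc j)"
  \<comment> \<open>For \<open>j \<ge> n\<close> the exponent \<open>n - Suc j\<close> is truncated, but then \<open>stirling n (Suc j) = 0\<close>.\<close>
proof (cases "j < n")
  case True
  then have "n - j = Suc (n - Suc j)" by simp
  then show ?thesis by (simp add: signed_stirling_def algebra_simps)
next
  case False
  then show ?thesis by (simp add: signed_stirling_def)
qed

text \<open>
  The Gumbel coefficients without their sign. Letting \<open>j\<close> range from \<open>0\<close> rather than from \<open>k\<close> adds only
  zero terms and makes the summation range independent of \<open>k\<close>.
\<close>

definition stirling_sum :: "real \<Rightarrow> nat \<Rightarrow> nat \<Rightarrow> real" where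
  "stirling_sum \<alpha> n k = (\<Sum>j\<le>n. \<alpha> ^ j * signed_stirling n j * real (Stirling j k))"

text \<open>
  The recursion of \<open>s(n, j)\<close> turns into an index shift in the Stirling numbers of the second kind; the terms
  at both ends of the range vanish.
\<close>

lemma stirling_sum_Suc:
  "stirling_sum \<alpha> (Suc n) k =
     \<alpha> * (\<Sum>j\<le>n. \<alpha> ^ j * signed_stirling n j * real (Stirling (Suc j) k)) - real n * stirling_sum \<alpha> n k"
proof -
  have "stirling_sum \<alpha> (Suc n) k =
      (\<Sum>j\<le>n. \<alpha> ^ Suc j * signed_stirling (Suc n) (Suc j) * real (Stirling (Suc j) k))"
    unfolding stirling_sum_def sum.atMost_Suc_shift by (simp add: signed_stirling_0)
  also have "\<dots> = \<alpha> * (\<Sum>j\<le>n. \<alpha> ^ j * signed_stirling n j * real (Stirling (Suc j) k)) -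
      real n * (\<Sum>j\<le>n. \<alpha> ^ Suc j * signed_stirling n (Suc j) * real (Stirling (Suc j) k))"
    by (simp only: signed_stirling_Suc sum_distrib_left sum_subtractf[symmetric])
      (rule sum.cong, auto simp: algebra_simps)
  also have "real n * (\<Sum>j\<le>n. \<alpha> ^ Suc j * signed_stirling n (Suc j) * real (Stirling (Suc j) k)) =
      real n * (\<Sum>j\<le>Suc n. \<alpha> ^ j * signed_stirling n j * real (Stirling j k))"
    unfolding sum.atMost_Suc_shift[of _ n] using signed_stirling_0(2)[of n]
    by (auto simp: distrib_left)
  also have "(\<Sum>j\<le>Suc n. \<alpha> ^ j * signed_stirling n j * real (Stirling j k)) = stirling_sum \<alpha> n k"
    by (simp add: stirling_sum_def signed_stirling_eq_0)
  finally show ?thesis .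
qed

lemma stirling_sum_rec:
  "stirling_sum \<alpha> (Suc n) 0 = - real n * stirling_sum \<alpha> n 0"
  "stirling_sum \<alpha> (Suc n) (Suc k) =
     \<alpha> * stirling_sum \<alpha> n k - (real n - \<alpha> * real (Suc k)) * stirling_sum \<alpha> n (Suc k)"
proof -
  show "stirling_sum \<alpha> (Suc n) 0 = - real n * stirling_sum \<alpha> n 0"
    by (simp add: stirling_sum_Suc)
  have "(\<Sum>j\<le>n. \<alpha> ^ j * signed_stirling n j * real (Stirling (Suc j) (Suc k))) =
      real (Suc k) * stirling_sum \<alpha> n (Suc k) + stirling_sum \<alpha> n k"
    unfolding stirling_sum_def sum_distrib_left sum.distrib[symmetric]
    by (rule sum.cong) (auto simp: algebra_simps)
  then show "stirling_sum \<alpha> (Suc n) (Suc k) =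
     \<alpha> * stirling_sum \<alpha> n k - (real n - \<alpha> * real (Suc k)) * stirling_sum \<alpha> n (Suc k)"
    unfolding stirling_sum_Suc by (simp add: algebra_simps)
qed

lemma stirling_sum_eq_0: "n < k \<Longrightarrow> stirling_sum \<alpha> n k = 0"
  by (simp add: stirling_sum_def)

lemma gumbel_coeff_stirling_sum:
  assumes "\<theta> \<noteq> 0"
  shows "gumbel_coeff n \<theta> k = (- 1) ^ (n - k) * stirling_sum (1 / \<theta>) n k"
proof -
  have "(\<Sum>j = k..n. \<theta> powi (- int j) * signed_stirling n j * real (Stirling j k)) = stirling_sum (1 / \<theta>) n k"
    unfolding stirling_sum_def
  proof (rule sum.mono_neutral_cong_left)
    show "\<forall>j\<in>{..n} - {k..n}. (1 / \<theta>) ^ j * signed_stirling n j * real (Stirling j k) = 0" by auto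
  qed (auto simp: power_int_minus power_one_over field_simps)
  then show ?thesis by (simp add: gumbel_coeff_def)
qed

text \<open>
  This is the recursion that differentiating \<open>e\<^sup>-\<^sup>x t\<^sup>-\<^sup>n x\<^sup>k\<close> with \<open>x = t\<^bsup>1/\<theta>\<^esup>\<close> dictates: the exponential yields
  the first term, the powers of \<open>t\<close> the second.
\<close>

lemma gumbel_coeff_rec:
  assumes "\<theta> \<noteq> 0"
  shows "gumbel_coeff (Suc n) \<theta> 0 = real n * gumbel_coeff n \<theta> 0"
    and "gumbel_coeff (Suc n) \<theta> (Suc k) =
      1 / \<theta> * gumbel_coeff n \<theta> k + (real n - 1 / \<theta> * real (Suc k)) * gumbel_coeff n \<theta> (Suc k)"
proof -
  note eq = gumbel_coeff_stirling_sum[OF assms]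
  show "gumbel_coeff (Suc n) \<theta> 0 = real n * gumbel_coeff n \<theta> 0"
    by (simp add: eq stirling_sum_rec)
  show "gumbel_coeff (Suc n) \<theta> (Suc k) =
      1 / \<theta> * gumbel_coeff n \<theta> k + (real n - 1 / \<theta> * real (Suc k)) * gumbel_coeff n \<theta> (Suc k)"
    \<comment> \<open>For \<open>k \<ge> n\<close> the exponent of the sign is truncated, but then the second term vanishes.\<close>
  proof (cases "k < n")
    case True
    then have "n - k = Suc (n - Suc k)" by simp
    then show ?thesis by (simp add: eq stirling_sum_rec algebra_simps)
  next
    case False
    then show ?thesis by (simp add: eq stirling_sum_rec stirling_sum_eq_0)
  qed
qed

lemma gumbel_coeff_eq_0: "n < k \<Longrightarrow> gumbel_coeff n \<theta> k = 0"
  by (simp add: gumbel_coeff_def)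

lemma gumbel_coeff_0: "gumbel_coeff 0 \<theta> 0 = 1"
  by (simp add: gumbel_coeff_def signed_stirling_def)

text \<open>
  Complete monotonicity of the Gumbel generator enters here. In the recursion the factor \<open>n - k / \<theta>\<close> is
  nonnegative for \<open>k \<le> n\<close> because \<open>\<theta> \<ge> 1\<close>, and for \<open>k > n\<close> its coefficient vanishes.
\<close>

lemma gumbel_coeff_nonneg:
  assumes "1 \<le> \<theta>"
  shows "0 \<le> gumbel_coeff n \<theta> k"
proof (induction n arbitrary: k)
  case 0
  then show ?case by (cases k) (auto simp: gumbel_coeff_0 gumbel_coeff_eq_0)
next
  case (Suc n)
  show ?case
  proof (cases k)
    case 0
    then show ?thesis using assms Suc[of 0] gumbel_coeff_rec(1)[of \<theta> n] by simp
  next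
    case (Suc m)
    have "0 \<le> (real n - 1 / \<theta> * real k) * gumbel_coeff n \<theta> k"
    proof (cases "k \<le> n")
      case True
      have "1 / \<theta> * real k \<le> 1 * real k" using assms by (intro mult_right_mono) auto
      then have "0 \<le> real n - 1 / \<theta> * real k" using True by linarith
      then show ?thesis using Suc.IH[of k] by (rule mult_nonneg_nonneg)
    qed (simp add: gumbel_coeff_eq_0)
    moreover have "0 \<le> 1 / \<theta> * gumbel_coeff n \<theta> m" using Suc.IH[of m] assms by simp
    ultimately show ?thesis using gumbel_coeff_rec(2)[of \<theta> n m] assms Suc by simp
  qed
qed

text \<open>
  The Gumbel polynomial with its constant term. That term is \<open>0\<close> for \<open>n \<ge> 1\<close> and \<open>1\<close> for \<open>n = 0\<close>, where it
  accounts for the generator itself.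
\<close>

definition gumbel_full_poly :: "nat \<Rightarrow> real \<Rightarrow> real \<Rightarrow> real" where
  "gumbel_full_poly n \<theta> x = (\<Sum>k\<le>n. gumbel_coeff n \<theta> k * x ^ k)"

lemma gumbel_full_poly_eq:
  assumes "1 \<le> n" "\<theta> \<noteq> 0"
  shows "gumbel_full_poly n \<theta> x = gumbel_poly n \<theta> x"
proof -
  have "gumbel_coeff (Suc m) \<theta> 0 = 0" for m
    by (induction m) (simp_all add: gumbel_coeff_rec(1)[OF assms(2)])
  then have "gumbel_coeff n \<theta> 0 = 0" using assms(1) by (cases n) auto
  then show ?thesis
    unfolding gumbel_full_poly_def gumbel_poly_def
    by (intro sum.mono_neutral_right) (auto simp: not_less_eq_eq)
qed

text \<open>
  The subtracted sum is \<open>x P'(x) / \<theta>\<close>, with \<open>P\<close> the polynomial of order \<open>n\<close>.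
\<close>

lemma gumbel_full_poly_Suc:
  assumes "\<theta> \<noteq> 0"
  shows "gumbel_full_poly (Suc n) \<theta> x = (x / \<theta> + real n) * gumbel_full_poly n \<theta> x -
    (\<Sum>k\<le>n. gumbel_coeff n \<theta> k * (real k / \<theta> * x ^ k))"
proof -
  let ?a = "gumbel_coeff n \<theta>"
  have "gumbel_full_poly (Suc n) \<theta> x = real n * ?a 0 +
      (\<Sum>k\<le>n. (1 / \<theta> * ?a k + (real n - 1 / \<theta> * real (Suc k)) * ?a (Suc k)) * x ^ Suc k)"
    unfolding gumbel_full_poly_def sum.atMost_Suc_shift gumbel_coeff_rec[OF assms] by simp
  also have "\<dots> = x / \<theta> * gumbel_full_poly n \<theta> x +
      (real n * ?a 0 + (\<Sum>k\<le>n. (real n - 1 / \<theta> * real (Suc k)) * ?a (Suc k) * x ^ Suc k))"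
    by (simp only: distrib_right sum.distrib)
      (simp add: gumbel_full_poly_def sum_distrib_left ac_simps)
  also have "real n * ?a 0 + (\<Sum>k\<le>n. (real n - 1 / \<theta> * real (Suc k)) * ?a (Suc k) * x ^ Suc k) =
      (\<Sum>k\<le>Suc n. (real n - 1 / \<theta> * real k) * ?a k * x ^ k)"
    unfolding sum.atMost_Suc_shift by simp
  also have "\<dots> = (\<Sum>k\<le>n. (real n - 1 / \<theta> * real k) * ?a k * x ^ k)"
    by (simp add: gumbel_coeff_eq_0)
  also have "\<dots> = real n * gumbel_full_poly n \<theta> x - (\<Sum>k\<le>n. ?a k * (real k / \<theta> * x ^ k))"
    unfolding gumbel_full_poly_def sum_distrib_left sum_subtractf[symmetric]
    by (rule sum.cong) (auto simp: algebra_simps)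
  finally show ?thesis by (simp add: algebra_simps)
qed

definition gumbel_cm :: "real \<Rightarrow> nat \<Rightarrow> real \<Rightarrow> real" where
  "gumbel_cm \<theta> n t = gumbel_gen \<theta> t / t ^ n * gumbel_full_poly n \<theta> (t powr (1 / \<theta>))"

lemma gumbel_cm_1:
  assumes "\<theta> \<noteq> 0"
  shows "gumbel_cm \<theta> 1 t = gumbel_gen \<theta> t / t * (t powr (1 / \<theta>) / \<theta>)"
  using gumbel_full_poly_Suc[OF assms, of 0]
  by (simp add: gumbel_cm_def gumbel_full_poly_def gumbel_coeff_0)

lemma gumbel_cm_deriv:
  assumes \<theta>: "\<theta> \<noteq> 0" and t: "0 < t"
  shows "(gumbel_cm \<theta> n has_real_derivative - gumbel_cm \<theta> (Suc n) t) (at t)"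
proof -
  define x where "x = (\<lambda>t::real. t powr (1 / \<theta>))"
  define D where "D = x t / \<theta> / t"
  have D: "(x has_real_derivative D) (at t)"
    unfolding x_def D_def using t \<theta> by (auto intro!: derivative_eq_intros simp: powr_diff)
  have gen: "((\<lambda>t. exp (- x t)) has_real_derivative - exp (- x t) * D) (at t)"
    using D by (auto intro!: derivative_eq_intros)
  have quot: "((\<lambda>t. exp (- x t) / t ^ n) has_real_derivative
      - (exp (- x t) / t ^ Suc n) * (x t / \<theta> + real n)) (at t)"
  proof (cases n)
    case 0
    then show ?thesis using gen t by (simp add: D_def mult.commute)
  next
    case (Suc m)
    show ?thesis
      by (rule derivative_eq_intros gen refl)+
        (use t \<theta> in \<open>auto simp: Suc D_def field_simps\<close>)
  qed
  have poly: "((\<lambda>t. gumbel_full_poly n \<theta> (x t)) has_real_derivative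
      (\<Sum>k\<le>n. gumbel_coeff n \<theta> k * (real k / \<theta> * x t ^ k)) / t) (at t)"
    unfolding gumbel_full_poly_def sum_divide_distrib
  proof (rule DERIV_sum)
    fix k
    have "((\<lambda>t. x t ^ k) has_real_derivative real k * x t ^ (k - Suc 0) * D) (at t)"
      using D by (auto intro!: derivative_eq_intros)
    also have "real k * x t ^ (k - Suc 0) * D = real k / \<theta> * x t ^ k / t"
      unfolding D_def by (cases k) auto
    finally show "((\<lambda>t. gumbel_coeff n \<theta> k * x t ^ k) has_real_derivative
        gumbel_coeff n \<theta> k * (real k / \<theta> * x t ^ k) / t) (at t)"
      using DERIV_cmult by fastforce
  qed
  let ?e = "exp (- x t)" and ?Q = "gumbel_full_poly n \<theta> (x t)"
    and ?S = "\<Sum>k\<le>n. gumbel_coeff n \<theta> k * (real k / \<theta> * x t ^ k)"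
  have "((\<lambda>t. exp (- x t) / t ^ n * gumbel_full_poly n \<theta> (x t)) has_real_derivative
      - (?e / t ^ Suc n) * (x t / \<theta> + real n) * ?Q + ?S / t * (?e / t ^ n)) (at t)"
    by (rule DERIV_mult[OF quot poly])
  also have "- (?e / t ^ Suc n) * (x t / \<theta> + real n) * ?Q + ?S / t * (?e / t ^ n) =
      - (?e / t ^ Suc n * ((x t / \<theta> + real n) * ?Q - ?S))"
    using t by (simp add: field_simps)
  finally show ?thesis
    unfolding gumbel_cm_def[abs_def] gumbel_gen_def x_def[symmetric]
    unfolding gumbel_full_poly_Suc[OF \<theta>] by (simp add: x_def)
qed

lemma cm_generator_gumbel:
  assumes \<theta>: "1 \<le> \<theta>"
  shows "cm_generator (gumbel_gen \<theta>) (gumbel_cm \<theta>)"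
proof
  show "gumbel_cm \<theta> 0 t = gumbel_gen \<theta> t" for t
    by (simp add: gumbel_cm_def gumbel_full_poly_def gumbel_coeff_0)
  show "gumbel_gen \<theta> 0 = 1" by (simp add: gumbel_gen_def)
  have "eventually (\<lambda>t::real. 0 \<le> t) (at_right 0)" by (rule eventually_at_rightI[of 0 1]) auto
  with \<theta> have "((\<lambda>t::real. t powr (1 / \<theta>)) \<longlongrightarrow> 0 powr (1 / \<theta>)) (at_right 0)"
    by (intro tendsto_powr'[OF tendsto_ident_at tendsto_const]) auto
  then have "(gumbel_gen \<theta> \<longlongrightarrow> exp (- (0 powr (1 / \<theta>)))) (at_right 0)"
    unfolding gumbel_gen_def[abs_def] by (rule tendsto_exp[OF tendsto_minus])
  then show "(gumbel_gen \<theta> \<longlongrightarrow> 1) (at_right 0)" by simp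
  have "filterlim (\<lambda>t::real. t powr (1 / \<theta>)) at_top at_top"
  proof (rule filterlim_cong[THEN iffD1, OF refl refl])
    show "filterlim (\<lambda>t. exp (1 / \<theta> * ln t)) at_top at_top"
      using \<theta> by (intro filterlim_compose[OF exp_at_top]
          filterlim_tendsto_pos_mult_at_top[OF tendsto_const _ ln_at_top]) auto
    show "eventually (\<lambda>t. exp (1 / \<theta> * ln t) = t powr (1 / \<theta>)) at_top"
      using eventually_gt_at_top[of 0] by eventually_elim (simp add: powr_def)
  qed
  then show "(gumbel_gen \<theta> \<longlongrightarrow> 0) at_top"
    unfolding gumbel_gen_def[abs_def]
    by (intro filterlim_compose[OF exp_at_bot]) (simp add: filterlim_uminus_at_top[symmetric])
  show "(gumbel_cm \<theta> n has_real_derivative - gumbel_cm \<theta> (Suc n) t) (at t)" if "0 < t" for n t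
    using gumbel_cm_deriv[OF _ that] \<theta> by simp
  show "0 \<le> gumbel_cm \<theta> n t" if "0 < t" for n t
    using that gumbel_coeff_nonneg[OF \<theta>] unfolding gumbel_cm_def gumbel_gen_def gumbel_full_poly_def
    by (intro mult_nonneg_nonneg sum_nonneg) auto
  show "0 < gumbel_cm \<theta> 1 t" if "0 < t" for t
    using that \<theta> by (simp only: gumbel_cm_1) (simp add: gumbel_gen_def)
qed

lemma gumbel_has_density:
  assumes \<theta>: "1 \<le> \<theta>" and d: "1 \<le> d"
  shows "arch_has_density d (gumbel_gen \<theta>) (gumbel_density d \<theta>)"
proof -
  interpret cm_generator "gumbel_gen \<theta>" "gumbel_cm \<theta>"
    by (rule cm_generator_gumbel[OF \<theta>])
  have inv: "1 / gumbel_cm \<theta> 1 (\<phi> u) = \<theta> * ((- ln u) powr (\<theta> - 1) / u)" if u: "0 < u" "u < 1" for u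
  proof -
    let ?x = "- ln u" and ?t = "(- ln u) powr \<theta>"
    have x: "0 < ?x" using u by simp
    have t: "0 \<le> ?t" "?t powr (1 / \<theta>) = ?x"
      using \<theta> x by (simp_all add: powr_powr)
    have t_eq: "?t = ?x powr (\<theta> - 1) * ?x"
      using x by (simp add: powr_diff)
    have gen: "gumbel_gen \<theta> ?t = u" unfolding gumbel_gen_def t(2) using u by simp
    then have "\<phi> u = ?t" using t(1) by (intro gen_inv_eq)
    moreover have "gumbel_cm \<theta> 1 ?t = u / ?t * (?x / \<theta>)"
      using gumbel_cm_1[of \<theta> ?t] \<theta> unfolding gen t(2) by simp
    then have "gumbel_cm \<theta> 1 ?t = u / (?x powr (\<theta> - 1) * ?x) * (?x / \<theta>)"
      unfolding t_eq[symmetric] .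
    ultimately show ?thesis using u x \<theta> by simp
  qed
  show ?thesis
  proof (rule has_density)
    fix u assume u: "u \<in> open_cube d"
    note u' = open_cubeD[OF u]
    have "(\<Prod>j = 1..d. 1 / gumbel_cm \<theta> 1 (\<phi> (u j))) =
        (\<Prod>j = 1..d. \<theta> * ((- ln (u j)) powr (\<theta> - 1) / u j))"
      using inv u' by (intro prod.cong) auto
    also have "\<dots> = \<theta> ^ d * ((\<Prod>j = 1..d. (- ln (u j)) powr (\<theta> - 1)) / (\<Prod>j = 1..d. u j))"
      by (simp add: prod.distrib prod_dividef)
    finally have jacobian: "(\<Prod>j = 1..d. 1 / gumbel_cm \<theta> 1 (\<phi> (u j))) =
        \<theta> ^ d * ((\<Prod>j = 1..d. (- ln (u j)) powr (\<theta> - 1)) / (\<Prod>j = 1..d. u j))" .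
    have copula: "arch_copula d (gumbel_gen \<theta>) u = gumbel_gen \<theta> (gen_sum d (gumbel_gen \<theta>) u)"
      using u' by (intro arch_copula_positive) auto
    have poly: "gumbel_full_poly d \<theta> = gumbel_poly d \<theta>"
      using gumbel_full_poly_eq[OF d] \<theta> by auto
    show "gumbel_density d \<theta> u = gumbel_cm \<theta> d (gen_sum d (gumbel_gen \<theta>) u) *
        (\<Prod>j = 1..d. 1 / gumbel_cm \<theta> 1 (\<phi> (u j)))"
      unfolding jacobian gumbel_density_def copula
      unfolding gumbel_cm_def poly by simp
  qed
qed

section \<open>The Joe family\<close>

text \<open>
  The coefficient of \<open>x\<^sup>k\<close> in the Joe polynomial. The falling factorial is reversed, so that its factors do not
  depend on \<open>k\<close>; this gives a recursion in \<open>k\<close>.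
\<close>

definition joe_shift_coeff :: "nat \<Rightarrow> real \<Rightarrow> nat \<Rightarrow> real" where
  "joe_shift_coeff n \<theta> k = real (Stirling n (Suc k)) * (\<Prod>i<k. real (Suc i) - 1 / \<theta>)"

lemma falling_factorial_joe:
  "falling_factorial (real k - 1 / \<theta>) k = (\<Prod>i<k. real (Suc i) - 1 / \<theta>)"
  unfolding falling_factorial_def
  by (rule prod.reindex_bij_witness[of _ "\<lambda>i. k - Suc i" "\<lambda>i. k - Suc i"]) (auto simp: of_nat_diff)

lemma joe_poly_shift: "joe_poly n \<theta> x = (\<Sum>k<n. joe_shift_coeff n \<theta> k * x ^ k)"
proof -
  have "joe_poly n \<theta> x = (\<Sum>k<n. joe_coeff n \<theta> (Suc k) * x ^ k)"
    unfolding joe_poly_def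
    by (rule sum.reindex_bij_witness[of _ Suc "\<lambda>k. k - 1"]) auto
  then show ?thesis
    by (simp add: joe_coeff_def joe_shift_coeff_def falling_factorial_joe)
qed

lemma joe_shift_coeff_eq_0: "n \<le> k \<Longrightarrow> joe_shift_coeff n \<theta> k = 0"
  by (simp add: joe_shift_coeff_def)

lemma joe_shift_coeff_rec:
  "joe_shift_coeff (Suc (Suc n)) \<theta> 0 = joe_shift_coeff (Suc n) \<theta> 0"
  "joe_shift_coeff (Suc n) \<theta> (Suc k) = real (Suc (Suc k)) * joe_shift_coeff n \<theta> (Suc k) +
     (real (Suc k) - 1 / \<theta>) * joe_shift_coeff n \<theta> k"
  by (auto simp: joe_shift_coeff_def algebra_simps add_divide_distrib)

text \<open>
  The remaining sum is \<open>P'(x)\<close>. In \<open>h (1 - h)\<^bsup>1/\<theta>-1\<^esup> P(x)\<close> with \<open>h = e\<^sup>-\<^sup>t\<close> and \<open>x = h / (1 - h)\<close>, the logarithmic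
  derivative of the prefactor is \<open>- (1 + (1 - 1/\<theta>) x)\<close>, and \<open>x\<close> has derivative \<open>- x (1 + x)\<close>. The
  polynomial of order \<open>n + 1\<close> belongs to minus the derivative.
\<close>

lemma joe_poly_Suc:
  assumes "1 \<le> n"
  shows "joe_poly (Suc n) \<theta> x = (1 + (1 - 1 / \<theta>) * x) * joe_poly n \<theta> x +
    x * (1 + x) * (\<Sum>k<n. joe_shift_coeff n \<theta> k * (real k * x ^ (k - 1)))"
proof -
  let ?b = "joe_shift_coeff n \<theta>"
  have b0: "joe_shift_coeff (Suc n) \<theta> 0 = ?b 0"
    using assms joe_shift_coeff_rec(1)[of "n - 1" \<theta>] by simp
  have "joe_poly (Suc n) \<theta> x = ?b 0 + (\<Sum>k<n. (real (Suc (Suc k)) * ?b (Suc k) +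
     (real (Suc k) - 1 / \<theta>) * ?b k) * x ^ Suc k)"
    unfolding joe_poly_shift sum.lessThan_Suc_shift b0 joe_shift_coeff_rec(2) by simp
  also have "\<dots> = (?b 0 + (\<Sum>k<n. real (Suc (Suc k)) * ?b (Suc k) * x ^ Suc k)) +
      (\<Sum>k<n. (real (Suc k) - 1 / \<theta>) * ?b k * x ^ Suc k)"
    by (simp only: distrib_right sum.distrib add.assoc)
  also have "?b 0 + (\<Sum>k<n. real (Suc (Suc k)) * ?b (Suc k) * x ^ Suc k) =
      (\<Sum>k<Suc n. real (Suc k) * ?b k * x ^ k)"
    unfolding sum.lessThan_Suc_shift by simp
  also have "\<dots> = (\<Sum>k<n. real (Suc k) * ?b k * x ^ k)"
    by (simp add: joe_shift_coeff_eq_0)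
  also have "\<dots> + (\<Sum>k<n. (real (Suc k) - 1 / \<theta>) * ?b k * x ^ Suc k) =
      (\<Sum>k<n. (1 + (1 - 1 / \<theta>) * x) * (?b k * x ^ k) + x * (1 + x) * (?b k * (real k * x ^ (k - 1))))"
    unfolding sum.distrib[symmetric]
  proof (rule sum.cong)
    fix k
    show "real (Suc k) * ?b k * x ^ k + (real (Suc k) - 1 / \<theta>) * ?b k * x ^ Suc k =
      (1 + (1 - 1 / \<theta>) * x) * (?b k * x ^ k) + x * (1 + x) * (?b k * (real k * x ^ (k - 1)))"
      by (cases k) (auto simp: algebra_simps)
  qed simp
  finally show ?thesis
    by (simp only: joe_poly_shift sum.distrib sum_distrib_left)
qed

text \<open>
  Here \<open>\<theta> \<ge> 1\<close> makes every factor \<open>i - 1/\<theta>\<close> with \<open>i \<ge> 1\<close> nonnegative.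
\<close>

lemma joe_poly_nonneg:
  assumes "1 \<le> \<theta>" "0 \<le> x"
  shows "0 \<le> joe_poly n \<theta> x"
proof -
  have "1 / \<theta> \<le> real (Suc i)" for i
  proof -
    have "1 / \<theta> \<le> 1" using assms by simp
    then show ?thesis by simp
  qed
  then show ?thesis
    unfolding joe_poly_shift joe_shift_coeff_def using assms
    by (intro sum_nonneg mult_nonneg_nonneg prod_nonneg) auto
qed

lemma joe_poly_1: "joe_poly (Suc 0) \<theta> x = 1"
  by (simp add: joe_poly_shift joe_shift_coeff_def)

text \<open>
  The generator is kept apart at order \<open>0\<close>: it contains the constant \<open>1\<close>, which the derivatives lose.
\<close>

definition joe_cm :: "real \<Rightarrow> nat \<Rightarrow> real \<Rightarrow> real" where
  "joe_cm \<theta> n t = (if n = 0 then joe_gen \<theta> t else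
     1 / \<theta> * (exp (- t) * (1 - exp (- t)) powr (1 / \<theta> - 1)) *
       joe_poly n \<theta> (exp (- t) / (1 - exp (- t))))"

lemma joe_cm_deriv:
  assumes \<theta>: "\<theta> \<noteq> 0" and t: "0 < t"
  shows "(joe_cm \<theta> n has_real_derivative - joe_cm \<theta> (Suc n) t) (at t)"
proof -
  define \<alpha> where "\<alpha> = 1 / \<theta>"
  define h where "h = (\<lambda>t::real. exp (- t))"
  have h: "0 < h t" "h t < 1" using t by (auto simp: h_def)
  have Dh: "(h has_real_derivative - h t) (at t)"
    unfolding h_def by (auto intro!: derivative_eq_intros)
  have Dpow: "((\<lambda>t. (1 - h t) powr a) has_real_derivative a * (1 - h t) powr (a - 1) * h t) (at t)" for a
    using Dh h by (auto intro!: derivative_eq_intros)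
  show ?thesis
  proof (cases "n = 0")
    case True
    have "((\<lambda>t. 1 - (1 - h t) powr \<alpha>) has_real_derivative 0 - \<alpha> * (1 - h t) powr (\<alpha> - 1) * h t) (at t)"
      by (intro DERIV_diff DERIV_const Dpow)
    then show ?thesis
      using True by (simp add: joe_cm_def[abs_def] joe_gen_def joe_poly_1 h_def \<alpha>_def mult.commute)
  next
    case False
    define x where "x = (\<lambda>t. h t / (1 - h t))"
    have "(x has_real_derivative (- h t * (1 - h t) - h t * h t) / ((1 - h t) * (1 - h t))) (at t)"
      unfolding x_def using Dh h by (auto intro!: derivative_eq_intros)
    also have "(- h t * (1 - h t) - h t * h t) / ((1 - h t) * (1 - h t)) = - (x t * (1 + x t))"
      using h by (simp add: x_def field_simps)
    finally have Dx: "(x has_real_derivative - (x t * (1 + x t))) (at t)" .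
    define k where "k = (\<lambda>t. h t * (1 - h t) powr (\<alpha> - 1))"
    have "(k has_real_derivative - h t * (1 - h t) powr (\<alpha> - 1) +
        (\<alpha> - 1) * (1 - h t) powr (\<alpha> - 1 - 1) * h t * h t) (at t)"
      unfolding k_def by (rule DERIV_mult[OF Dh Dpow])
    also have "(1 - h t) powr (\<alpha> - 1 - 1) = (1 - h t) powr (\<alpha> - 1) / (1 - h t)"
      using h by (simp add: powr_diff power2_eq_square)
    also have "- h t * (1 - h t) powr (\<alpha> - 1) +
        (\<alpha> - 1) * ((1 - h t) powr (\<alpha> - 1) / (1 - h t)) * h t * h t = - (1 + (1 - \<alpha>) * x t) * k t"
      using h by (simp add: k_def x_def field_simps)
    finally have Dk: "(k has_real_derivative - (1 + (1 - \<alpha>) * x t) * k t) (at t)" .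
    let ?S = "\<Sum>k<n. joe_shift_coeff n \<theta> k * (real k * x t ^ (k - 1))"
    have DP: "((\<lambda>t. joe_poly n \<theta> (x t)) has_real_derivative ?S * - (x t * (1 + x t))) (at t)"
      unfolding joe_poly_shift sum_distrib_right
      by (rule DERIV_sum) (use Dx in \<open>auto intro!: derivative_eq_intros\<close>)
    have "((\<lambda>t. k t * joe_poly n \<theta> (x t)) has_real_derivative
        - (1 + (1 - \<alpha>) * x t) * k t * joe_poly n \<theta> (x t) + ?S * - (x t * (1 + x t)) * k t) (at t)"
      by (rule DERIV_mult[OF Dk DP])
    also have "- (1 + (1 - \<alpha>) * x t) * k t * joe_poly n \<theta> (x t) + ?S * - (x t * (1 + x t)) * k t =
        - (k t * joe_poly (Suc n) \<theta> (x t))"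
      using False by (subst joe_poly_Suc) (simp_all add: \<alpha>_def algebra_simps)
    finally have "((\<lambda>t. k t * joe_poly n \<theta> (x t)) has_real_derivative
        - (k t * joe_poly (Suc n) \<theta> (x t))) (at t)" .
    from DERIV_cmult[OF this, of \<alpha>]
    show ?thesis
      using False by (simp add: joe_cm_def[abs_def] k_def x_def h_def \<alpha>_def mult.assoc)
  qed
qed

lemma cm_generator_joe:
  assumes \<theta>: "1 \<le> \<theta>"
  shows "cm_generator (joe_gen \<theta>) (joe_cm \<theta>)"
proof
  show "joe_cm \<theta> 0 t = joe_gen \<theta> t" for t by (simp add: joe_cm_def)
  show "joe_gen \<theta> 0 = 1" by (simp add: joe_gen_def)
  have "((\<lambda>t::real. (1 - exp (- t)) powr (1 / \<theta>)) \<longlongrightarrow> (1 - exp (- 0)) powr (1 / \<theta>)) (at_right 0)"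
  proof (rule tendsto_powr')
    have "eventually (\<lambda>t::real. 0 \<le> 1 - exp (- t)) (at_right 0)"
      by (rule eventually_at_rightI[of 0 1]) auto
    then show "1 - exp (- 0) \<noteq> (0::real) \<or> 0 < 1 / \<theta> \<and> (\<forall>\<^sub>F t in at_right 0. (0::real) \<le> 1 - exp (- t))"
      using \<theta> by simp
  qed (intro tendsto_intros)+
  then have "(joe_gen \<theta> \<longlongrightarrow> 1 - (1 - exp (- 0)) powr (1 / \<theta>)) (at_right 0)"
    unfolding joe_gen_def[abs_def] by (rule tendsto_diff[OF tendsto_const])
  then show "(joe_gen \<theta> \<longlongrightarrow> 1) (at_right 0)" by simp
  have "((\<lambda>t. exp (- t :: real)) \<longlongrightarrow> 0) at_top"
    by (rule filterlim_compose[OF exp_at_bot filterlim_uminus_at_bot_at_top])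
  then have "(joe_gen \<theta> \<longlongrightarrow> 1 - (1 - 0) powr (1 / \<theta>)) at_top"
    unfolding joe_gen_def[abs_def] by (intro tendsto_intros) auto
  then show "(joe_gen \<theta> \<longlongrightarrow> 0) at_top" by simp
  show "(joe_cm \<theta> n has_real_derivative - joe_cm \<theta> (Suc n) t) (at t)" if "0 < t" for n t
    using joe_cm_deriv[OF _ that] \<theta> by simp
  show "0 \<le> joe_cm \<theta> n t" if "0 < t" for n t
  proof (cases "n = 0")
    case True
    have "(1 - exp (- t)) powr (1 / \<theta>) \<le> 1"
      using that \<theta> by (intro powr_le1) auto
    then show ?thesis using True by (simp add: joe_cm_def joe_gen_def)
  next
    case False
    then show ?thesis
      using \<theta> that joe_poly_nonneg[OF \<theta>, of "exp (- t) / (1 - exp (- t))" n] by (simp add: joe_cm_def)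
  qed
  show "0 < joe_cm \<theta> 1 t" if "0 < t" for t
    using \<theta> that by (simp add: joe_cm_def joe_poly_1)
qed

lemma joe_has_density:
  assumes \<theta>: "1 \<le> \<theta>" and d: "1 \<le> d"
  shows "arch_has_density d (joe_gen \<theta>) (joe_density d \<theta>)"
proof -
  interpret cm_generator "joe_gen \<theta>" "joe_cm \<theta>"
    by (rule cm_generator_joe[OF \<theta>])
  have inv: "exp (- \<phi> u) = 1 - (1 - u) powr \<theta>"
    "1 / joe_cm \<theta> 1 (\<phi> u) = \<theta> * ((1 - u) powr (\<theta> - 1) / (1 - (1 - u) powr \<theta>))"
    if u: "0 < u" "u < 1" for u
  proof -
    let ?h = "1 - (1 - u) powr \<theta>"
    have "(1 - u) powr \<theta> < 1 powr \<theta>"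
      using u \<theta> by (intro powr_less_mono2) auto
    then have h: "0 < ?h" "?h \<le> 1" by auto
    let ?t = "- ln ?h"
    have t: "0 \<le> ?t" "exp (- ?t) = ?h" using h by auto
    have "joe_gen \<theta> ?t = u"
      unfolding joe_gen_def t(2) using u \<theta> by (simp add: powr_powr)
    then have phi: "\<phi> u = ?t" using t(1) by (intro gen_inv_eq)
    show x: "exp (- \<phi> u) = ?h" unfolding phi t(2) ..
    have "\<theta> * (1 / \<theta> - 1) = - (\<theta> - 1)" using \<theta> by (simp add: field_simps)
    then have "(1 - ?h) powr (1 / \<theta> - 1) = 1 / (1 - u) powr (\<theta> - 1)"
      using powr_minus_divide[of "1 - u" "\<theta> - 1"] by (simp add: powr_powr)
    then show "1 / joe_cm \<theta> 1 (\<phi> u) = \<theta> * ((1 - u) powr (\<theta> - 1) / ?h)"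
      by (simp add: joe_cm_def joe_poly_1 x)
  qed
  show ?thesis
  proof (rule has_density)
    fix u assume u: "u \<in> open_cube d"
    note u' = open_cubeD[OF u]
    let ?T = "gen_sum d (joe_gen \<theta>) u"
    define h where "h = joe_h d \<theta> u"
    have "h = (\<Prod>j = 1..d. exp (- \<phi> (u j)))"
      unfolding h_def joe_h_def using inv(1) u' by (intro prod.cong) auto
    also have "\<dots> = exp (- ?T)"
      unfolding gen_sum_def sum_negf[symmetric] exp_sum[OF finite_atLeastAtMost] ..
    finally have T: "exp (- ?T) = h" ..
    have "0 < h" using T exp_gt_zero by metis
    have "0 < ?T" unfolding gen_sum_def using u' d by (intro sum_pos gen_inv_pos) auto
    then have "h < 1" unfolding T[symmetric] by simp
    have "(\<Prod>j = 1..d. 1 / joe_cm \<theta> 1 (\<phi> (u j))) =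
        (\<Prod>j = 1..d. \<theta> * ((1 - u j) powr (\<theta> - 1) / (1 - (1 - u j) powr \<theta>)))"
      using inv(2) u' by (intro prod.cong) auto
    also have "\<dots> = \<theta> ^ d * ((\<Prod>j = 1..d. (1 - u j) powr (\<theta> - 1)) / h)"
      by (simp add: prod.distrib prod_dividef h_def joe_h_def)
    finally have jacobian: "(\<Prod>j = 1..d. 1 / joe_cm \<theta> 1 (\<phi> (u j))) =
        \<theta> ^ d * ((\<Prod>j = 1..d. (1 - u j) powr (\<theta> - 1)) / h)" .
    have "(1 - h) powr (1 / \<theta> - 1) = 1 / (1 - h) powr (1 - 1 / \<theta>)"
      using powr_minus_divide[of "1 - h" "1 - 1 / \<theta>"] by simp
    then have deriv: "joe_cm \<theta> d ?T = 1 / \<theta> * (h / (1 - h) powr (1 - 1 / \<theta>)) * joe_poly d \<theta> (h / (1 - h))"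
      using d by (simp add: joe_cm_def T)
    have "\<theta> ^ d = \<theta> * \<theta> ^ (d - 1)" using d by (cases d) auto
    then show "joe_density d \<theta> u = joe_cm \<theta> d ?T * (\<Prod>j = 1..d. 1 / joe_cm \<theta> 1 (\<phi> (u j)))"
      unfolding joe_density_def jacobian deriv h_def[symmetric]
      using \<open>0 < h\<close> \<theta> by simp
  qed
qed

section \<open>The five families together\<close>

theorem corollary3p3:
  fixes d :: nat
  assumes "d \<ge> 2"
  shows
    "(\<forall>\<theta>\<in>{0<..<1}. arch_has_density d (amh_gen \<theta>) (amh_density d \<theta>)) \<and>
     (\<forall>u\<in>open_cube d. \<exists>l. ((\<lambda>\<theta>. amh_density d \<theta> u) \<longlongrightarrow> l) (at_right 0)) \<and>
     arch_has_density d (amh_gen 0) (\<lambda>u. Lim (at_right 0) (\<lambda>\<theta>. amh_density d \<theta> u)) \<and>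
     (\<forall>\<theta>>0. arch_has_density d (clayton_gen \<theta>) (clayton_density d \<theta>)) \<and>
     (\<forall>\<theta>>0. arch_has_density d (frank_gen \<theta>) (frank_density d \<theta>)) \<and>
     (\<forall>\<theta>\<ge>1. arch_has_density d (gumbel_gen \<theta>) (gumbel_density d \<theta>)) \<and>
     (\<forall>\<theta>\<ge>1. arch_has_density d (joe_gen \<theta>) (joe_density d \<theta>))"
proof (intro conjI ballI allI impI)
  have d: "1 \<le> d" using assms by simp
  show "arch_has_density d (amh_gen \<theta>) (amh_density d \<theta>)" if "\<theta> \<in> {0<..<1}" for \<theta>
    using that by (intro amh_has_density_ext amh_density_eq_ext) auto
  show "\<exists>l. ((\<lambda>\<theta>. amh_density d \<theta> u) \<longlongrightarrow> l) (at_right 0)" if "u \<in> open_cube d" for u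
    using amh_density_limit[OF that] by blast
  show "arch_has_density d (amh_gen 0) (\<lambda>u. Lim (at_right 0) (\<lambda>\<theta>. amh_density d \<theta> u))"
    by (intro amh_has_density_ext tendsto_Lim amh_density_limit) auto
  show "arch_has_density d (clayton_gen \<theta>) (clayton_density d \<theta>)" if "\<theta> > 0" for \<theta>
    using that by (rule clayton_has_density)
  show "arch_has_density d (frank_gen \<theta>) (frank_density d \<theta>)" if "\<theta> > 0" for \<theta>
    using that d by (rule frank_has_density)
  show "arch_has_density d (gumbel_gen \<theta>) (gumbel_density d \<theta>)" if "\<theta> \<ge> 1" for \<theta>
    using that d by (rule gumbel_has_density)
  show "arch_has_density d (joe_gen \<theta>) (joe_density d \<theta>)" if "\<theta> \<ge> 1" for \<theta>
    using that d by (rule joe_has_density)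
qed

end
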